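(* Let $n\ge 1$, $\varepsilon>0$, $0<s<1$, and let $P\in L^1(\mathbf{R}^n)$ satisfy, for every integer $j\ge 1$, $$\int_{2^{j-1}\le |x|\le 2^{j}}|P(x)|\,dx \lesssim 2^{-j(\varepsilon+s)},\qquad \int_{|x|\le 1}|P(x)|\,dx\lesssim 1,$$ with implied constants independent of $j$. For $k\in\mathbf{Z}$ set $P_k(x)=2^{nk}P(2^kx)$. Let $1\le p,q,r\le\infty$ with $\frac1p+\frac1q=\frac1r$. Then there is a constant $C>0$ such that for all $k\in\mathbf{Z}$ and all $f,g\in\mathcal{S}(\mathbf{R}^n)$, $$\left\|\int_{\mathbf{R}^n} P_k(y)\,\bigl(f(x)-f(x-y)\bigr)\,g(x-y)\,dy\right\|_{L^r_x}\le C\,2^{-ks}\,\bigl\||D|^s f\bigr\|_{L^p}\,\|g\|_{L^q}.$$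
   Context: $\mathcal{S}(\mathbf{R}^n)$ is the Schwartz space. The Fourier transform is $\hat f(\xi)=\int_{\mathbf{R}^n} f(x)e^{-2\pi i x\cdot\xi}\,dx$, and $|D|^s$ is the Fourier multiplier operator with symbol $|\xi|^s$, i.e. $\widehat{|D|^s f}(\xi)=|\xi|^s\hat f(\xi)$. The notation $a\lesssim b$ means $a\le Cb$ for some constant $C>0$. All $L^p$ norms are over $\mathbf{R}^n$ with Lebesgue measure. *)

theory Defs
  imports "HOL-Probability.Essential_Supremum"
begin

definition partial_deriv ::
    "'a::euclidean_space \<Rightarrow> ('a \<Rightarrow> complex) \<Rightarrow> 'a \<Rightarrow> complex" where
  "partial_deriv b f = (\<lambda>x. frechet_derivative f (at x) b)"

definition iter_partial_deriv ::
    "'a::euclidean_space list \<Rightarrow> ('a \<Rightarrow> complex) \<Rightarrow> 'a \<Rightarrow> complex" where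
  "iter_partial_deriv bs f = foldr partial_deriv bs f"

text \<open>
  A list of standard basis vectors plays the role of a multi-index.  Differentiability of all
  iterated partial derivatives makes the function smooth; without it the value of
  \<^const>\<open>frechet_derivative\<close> would be unspecified.
\<close>
definition schwartz :: "('a::euclidean_space \<Rightarrow> complex) set" where
  "schwartz = {f. \<forall>bs. set bs \<subseteq> Basis \<longrightarrow>
      (\<forall>x. iter_partial_deriv bs f differentiable (at x)) \<and>
      (\<forall>N::nat. \<exists>B::real. \<forall>x. norm x ^ N * norm (iter_partial_deriv bs f x) \<le> B)}"

definition fourier :: "('a::euclidean_space \<Rightarrow> complex) \<Rightarrow> 'a \<Rightarrow> complex" where
  "fourier f \<xi> = (LINT x|lebesgue. f x * cis (- 2 * pi * (x \<bullet> \<xi>)))"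

definition inverse_fourier :: "('a::euclidean_space \<Rightarrow> complex) \<Rightarrow> 'a \<Rightarrow> complex" where
  "inverse_fourier h x = (LINT \<xi>|lebesgue. h \<xi> * cis (2 * pi * (x \<bullet> \<xi>)))"

text \<open>
  For a Schwartz function and a symbol of polynomial growth the integrand of the inverse
  transform is absolutely integrable, so the operator is defined pointwise.
\<close>
definition fourier_multiplier ::
    "('a::euclidean_space \<Rightarrow> complex) \<Rightarrow> ('a \<Rightarrow> complex) \<Rightarrow> 'a \<Rightarrow> complex" where
  "fourier_multiplier m f = inverse_fourier (\<lambda>\<xi>. m \<xi> * fourier f \<xi>)"

definition abs_D_powr ::
    "real \<Rightarrow> ('a::euclidean_space \<Rightarrow> complex) \<Rightarrow> 'a \<Rightarrow> complex" where
  "abs_D_powr s = fourier_multiplier (\<lambda>\<xi>. of_real (norm \<xi> powr s))"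

text \<open>Intended for exponents \<open>t > 0\<close>, where \<open>\<infinity>\<close> raised to \<open>t\<close> is \<open>\<infinity>\<close>.\<close>
definition ennreal_powr :: "ennreal \<Rightarrow> real \<Rightarrow> ennreal" where
  "ennreal_powr a t = (if a = \<infinity> then \<infinity> else ennreal (enn2real a powr t))"

text \<open>The exponent ranges over \<open>[1, \<infinity>]\<close>; the norm may take the value \<open>\<infinity>\<close>.\<close>
definition Lp_norm :: "ennreal \<Rightarrow> ('a::euclidean_space \<Rightarrow> complex) \<Rightarrow> ennreal" where
  "Lp_norm p h =
     (if p = \<infinity> then esssup lebesgue (\<lambda>x. ennreal (norm (h x)))
      else ennreal_powr (\<integral>\<^sup>+ x. ennreal (norm (h x) powr enn2real p) \<partial>lebesgue) (1 / enn2real p))"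

definition dyadic_dilation ::
    "int \<Rightarrow> ('a::euclidean_space \<Rightarrow> complex) \<Rightarrow> 'a \<Rightarrow> complex" where
  "dyadic_dilation k P x = of_real (2 powi (int DIM('a) * k)) * P ((2 powi k) *\<^sub>R x)"

end

theory Submission
  imports Defs "HOL-Probability.Probability"
begin

text \<open>
  Everything reduces to the modulus of continuity
  \<open>\<parallel>f - f(\<cdot> - y)\<parallel>\<^sub>p \<le> C |y|\<^sup>s \<parallel>|D|\<^sup>s f\<parallel>\<^sub>p\<close>: given it, the theorem follows from the integral Minkowski
  inequality in \<open>y\<close>, Hoelder's inequality in \<open>x\<close> and the finiteness of \<open>\<integral> |P(y)| |y|\<^sup>s dy\<close>.
  For the modulus of continuity, write \<open>|\<xi>|\<^sup>-\<^sup>s\<close> as a multiple of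
  \<open>\<integral> \<tau>\<^sup>s\<^sup>-\<^sup>1 exp (- 2 \<pi>\<^sup>2 \<tau>\<^sup>2 |\<xi>|\<^sup>2) d\<tau>\<close> over \<open>\<tau> > 0\<close>. With \<open>G\<close> the standard Gaussian density, Fourier
  inversion then gives, up to a constant,
  \<open>f(x) - f(x - y) = \<integral> \<tau>\<^sup>s\<^sup>-\<^sup>1 \<integral> (G(z) - G(z - y/\<tau>)) (|D|\<^sup>s f)(x - \<tau> z) dz d\<tau>\<close>,
  and since \<open>\<parallel>G - G(\<cdot> - w)\<parallel>\<^sub>1 \<le> 3 min 1 |w|\<close>, the kernel has total mass \<open>O(|y|\<^sup>s)\<close> exactly because
  \<open>0 < s < 1\<close>.
\<close>

text \<open>The representation has to be one for a difference of f: a single Gaussian average has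
  mass 1 at every scale, and the integral of \<open>\<tau> powr (s - 1)\<close> over \<tau> > 0
  diverges. Subtracting the translate leaves mass at most 3 for \<tau> < |y|, where s > 0 gives
  convergence at 0, and at most 3 |y| / \<tau> for \<tau> > |y|, where s < 1 gives convergence at
  infinity. An integrable kernel treats p = 1 and p = \<infinity> like every other exponent. The
  symbol |\<xi>|^s is not smooth at 0, so |D|^s f is handled only as the inverse transform of an
  integrable function, hence as a bounded Borel function; inversion is applied to f alone. In the
  final step the factor |y|^s is moved into the measure |P_k(y)| |y|^s dy, so that the remaining
  integrand is bounded in L^r uniformly in y. Homogeneity of |y|^s makes the mass of that measure
  2^(-k s) times the one for k = 0, and the annulus hypothesis makes the latter finite, with margin
  \<epsilon>.\<close>

section \<open>Bounds on Lebesgue norms\<close>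

text \<open>Meant for \<open>h \<ge> 0\<close>.  The real bound \<open>B\<close> avoids arithmetic with infinite norms.\<close>
definition Lp_le :: "'b measure \<Rightarrow> ennreal \<Rightarrow> ('b \<Rightarrow> real) \<Rightarrow> real \<Rightarrow> bool" where
  "Lp_le M p h B \<longleftrightarrow>
     (if p = \<infinity> then AE x in M. h x \<le> B
      else (\<integral>\<^sup>+ x. ennreal (h x powr enn2real p) \<partial>M) \<le> ennreal (B powr enn2real p))"

section \<open>Convexity inequalities for real powers\<close>

lemma young_powr:
  fixes a b \<alpha> \<beta> :: real
  assumes "0 < \<alpha>" "0 < \<beta>" "\<alpha> + \<beta> = 1" "0 \<le> a" "0 \<le> b"
  shows "a powr \<alpha> * b powr \<beta> \<le> \<alpha> * a + \<beta> * b"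
  using Youngs_inequality_0[of \<alpha> \<beta> a b] assms
  by (cases "a = 0 \<or> b = 0") auto

text \<open>Convexity in tangent-line form, derived from Young's inequality with weights 1/t and 1 -
  1/t instead of derivatives, so that h = 0 is included. It supplies the Jensen step of
  \<open>Lp_le_integral\<close>.\<close>

lemma powr_tangent_le:
  fixes a h t :: real
  assumes "1 \<le> t" "0 < a" "0 \<le> h"
  shows "a powr t + t * a powr (t - 1) * (h - a) \<le> h powr t"
proof (cases "t = 1")
  case True
  then show ?thesis using assms by simp
next
  case False
  then have t: "1 < t" using assms by simp
  have "(h powr t) powr (1 / t) * (a powr t) powr (1 - 1 / t)
      \<le> (1 / t) * h powr t + (1 - 1 / t) * a powr t"
    using t by (intro young_powr) (auto simp: field_simps)
  moreover have "(h powr t) powr (1 / t) = h" "(a powr t) powr (1 - 1 / t) = a powr (t - 1)"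
    using t assms by (auto simp: powr_powr right_diff_distrib)
  ultimately have "t * (h * a powr (t - 1)) \<le> t * ((1 / t) * h powr t + (1 - 1 / t) * a powr t)"
    using t by (intro mult_left_mono) auto
  also have "\<dots> = h powr t + (t - 1) * a powr t"
    using t by (simp add: field_simps)
  finally have "t * (h * a powr (t - 1)) \<le> h powr t + (t - 1) * a powr t" .
  moreover have "a powr t = a powr (t - 1) * a"
    using assms by (simp add: powr_diff)
  ultimately show ?thesis by (simp add: algebra_simps)
qed

lemma ennreal_ge_1_cases:
  assumes "1 \<le> (p :: ennreal)"
  obtains "p = \<infinity>" | "p \<noteq> \<infinity>" "1 \<le> enn2real p" "p = ennreal (enn2real p)"
proof (cases p)
  case (real t)
  then have "1 \<le> t"
    using assms ennreal_le_iff[of t 1] by simp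
  then show ?thesis using that(2) real by simp
qed (use that in auto)

section \<open>Monotonicity, Hoelder, translation and Minkowski for \<open>Lp_le\<close>\<close>

lemma Lp_le_mono:
  assumes "Lp_le M p h B" "\<And>x. h' x \<le> h x" "\<And>x. 0 \<le> h' x"
  shows "Lp_le M p h' B"
proof (cases "p = \<infinity>")
  case True
  then show ?thesis
    using assms(1) by (auto simp: Lp_le_def elim!: eventually_mono intro: order_trans[OF assms(2)])
next
  case False
  have "(\<integral>\<^sup>+ x. ennreal (h' x powr enn2real p) \<partial>M) \<le> (\<integral>\<^sup>+ x. ennreal (h x powr enn2real p) \<partial>M)"
    using assms by (intro nn_integral_mono ennreal_leI powr_mono2) auto
  also have "\<dots> \<le> ennreal (B powr enn2real p)"
    using assms(1) False by (simp add: Lp_le_def)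
  finally show ?thesis using False by (simp add: Lp_le_def)
qed

lemma Lp_le_bound_mono:
  assumes "Lp_le M p h B" "0 \<le> B" "B \<le> B'"
  shows "Lp_le M p h B'"
proof (cases "p = \<infinity>")
  case True
  then show ?thesis using assms by (auto simp: Lp_le_def elim!: eventually_mono)
next
  case False
  have "ennreal (B powr enn2real p) \<le> ennreal (B' powr enn2real p)"
    using assms by (intro ennreal_leI powr_mono2) auto
  then show ?thesis using assms(1) False by (auto simp: Lp_le_def intro: order_trans)
qed

lemma Lp_le_cmult:
  assumes [measurable]: "h \<in> borel_measurable M" and "\<And>x. 0 \<le> h x" "0 \<le> c" "0 \<le> B" "Lp_le M p h B"
  shows "Lp_le M p (\<lambda>x. c * h x) (c * B)"
proof (cases "p = \<infinity>")
  case True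
  then show ?thesis
    using assms(5) unfolding Lp_le_def
    by (auto elim!: eventually_mono intro: mult_left_mono assms)
next
  case False
  let ?t = "enn2real p"
  have "(\<integral>\<^sup>+ x. ennreal ((c * h x) powr ?t) \<partial>M) = (\<integral>\<^sup>+ x. ennreal (c powr ?t) * ennreal (h x powr ?t) \<partial>M)"
    using assms by (simp add: powr_mult ennreal_mult)
  also have "\<dots> = ennreal (c powr ?t) * (\<integral>\<^sup>+ x. ennreal (h x powr ?t) \<partial>M)"
    by (rule nn_integral_cmult) simp
  also have "\<dots> \<le> ennreal (c powr ?t) * ennreal (B powr ?t)"
    using assms(5) False by (intro mult_left_mono) (auto simp: Lp_le_def)
  also have "\<dots> = ennreal ((c * B) powr ?t)"
    using assms by (simp add: powr_mult ennreal_mult)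
  finally show ?thesis using False by (simp add: Lp_le_def)
qed

lemma Lp_le_mult_infinity:
  assumes [measurable]: "v \<in> borel_measurable M" and "\<And>x. 0 \<le> u x" "\<And>x. 0 \<le> v x"
    and "0 \<le> A" "0 \<le> B" "Lp_le M \<infinity> u A" "Lp_le M p v B"
  shows "Lp_le M p (\<lambda>x. u x * v x) (A * B)"
proof (cases "p = \<infinity>")
  case True
  have "AE x in M. u x \<le> A" "AE x in M. v x \<le> B"
    using assms True by (auto simp: Lp_le_def)
  then have "AE x in M. u x * v x \<le> A * B"
    by eventually_elim (auto intro: mult_mono assms)
  then show ?thesis using True by (simp add: Lp_le_def)
next
  case False
  let ?t = "enn2real p"
  have "AE x in M. u x \<le> A"
    using assms by (auto simp: Lp_le_def)
  then have "AE x in M. ennreal ((u x * v x) powr ?t) \<le> ennreal ((A * v x) powr ?t)"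
    by eventually_elim (auto intro!: ennreal_leI powr_mono2 mult_right_mono mult_nonneg_nonneg assms)
  then have "(\<integral>\<^sup>+ x. ennreal ((u x * v x) powr ?t) \<partial>M) \<le> (\<integral>\<^sup>+ x. ennreal ((A * v x) powr ?t) \<partial>M)"
    by (rule nn_integral_mono_AE)
  also have "\<dots> \<le> ennreal ((A * B) powr ?t)"
    using Lp_le_cmult[OF assms(1,3,4,5,7)] False by (simp add: Lp_le_def)
  finally show ?thesis using False by (simp add: Lp_le_def)
qed

text \<open>Young's inequality is applied pointwise to powers of u/A and v/B, with weights R/P and
  R/Q that add up to 1; dividing by the bounds instead of the norms is why A and B are positive. An
  infinite p or q is split off first, the exponent relation then forcing the other one to equal
  r.\<close>

lemma Lp_le_mult:
  assumes [measurable]: "u \<in> borel_measurable M" "v \<in> borel_measurable M"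
    and nn: "\<And>x. 0 \<le> u x" "\<And>x. 0 \<le> v x" and AB: "0 < A" "0 < B"
    and pqr: "1 \<le> p" "1 \<le> q" "1 \<le> r" "1 / p + 1 / q = 1 / r"
    and u: "Lp_le M p u A" and v: "Lp_le M q v B"
  shows "Lp_le M r (\<lambda>x. u x * v x) (A * B)"
proof -
  \<comment> \<open>Inversion is an involution on all of \<open>ennreal\<close>, exchanging 0 and
    \<infinity>, so exponents can be recovered from their reciprocals.\<close>
  have inv_inv: "inverse (inverse x) = x" for x :: ennreal
    using divide_ennreal_def one_divide_one_divide_ennreal by force
  have inv: "inverse p + inverse q = inverse r"
    using pqr(4) by (simp add: divide_ennreal_def)
  consider "p = \<infinity>" | "q = \<infinity>" | "p \<noteq> \<infinity>" "q \<noteq> \<infinity>" by blast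
  then show ?thesis
  proof cases
    case 1
    then have "q = r"
      using inv by (metis add_0 ennreal_inverse_top infinity_ennreal_def inv_inv)
    then show ?thesis
      using Lp_le_mult_infinity[of v M u A B r] assms 1 by simp
  next
    case 2
    then have "p = r"
      using inv by (metis add_0_right ennreal_inverse_top infinity_ennreal_def inv_inv)
    then show ?thesis
      using Lp_le_mult_infinity[of u M v B A r] assms 2 by (simp add: mult.commute)
  next
    case 3
    obtain P where P: "p = ennreal P" "1 \<le> P"
      using pqr(1) 3 by (metis ennreal_ge_1_cases)
    obtain Q where Q: "q = ennreal Q" "1 \<le> Q"
      using pqr(2) 3 by (metis ennreal_ge_1_cases)
    have "inverse r = ennreal (1 / P + 1 / Q)"
      using inv P Q by (simp add: inverse_ennreal inverse_eq_divide ennreal_plus)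
    then have "r = ennreal (inverse (1 / P + 1 / Q))"
      using P Q by (metis add_pos_pos inverse_ennreal inv_inv less_le_trans zero_less_divide_1_iff zero_less_one)
    then obtain R where R: "r = ennreal R" "R > 0" "1 / R = 1 / P + 1 / Q"
      using P Q by (intro that[of "inverse (1 / P + 1 / Q)"]) (auto simp: add_pos_pos inverse_eq_divide)
    have "R / P + R / Q = R * (1 / R)"
      unfolding R(3) by (simp add: distrib_left)
    then have sum1: "R / P + R / Q = 1"
      unfolding R(3)[symmetric] using R(2) by simp
    have u': "(\<integral>\<^sup>+ x. ennreal (u x powr P) \<partial>M) \<le> ennreal (A powr P)"
      using u P 3 by (simp add: Lp_le_def)
    have v': "(\<integral>\<^sup>+ x. ennreal (v x powr Q) \<partial>M) \<le> ennreal (B powr Q)"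
      using v Q 3 by (simp add: Lp_le_def)
    \<comment> \<open>Young for the normalised powers, multiplied through by
      \<open>(A * B) powr R\<close>; the coefficients are chosen to add up to exactly that factor
      once the bounds on u and v are inserted.\<close>
    have pt: "(u x * v x) powr R \<le>
        (A * B) powr R * (R / P / A powr P) * u x powr P + (A * B) powr R * (R / Q / B powr Q) * v x powr Q" for x
    proof -
      have "((u x / A) powr P) powr (R / P) * ((v x / B) powr Q) powr (R / Q)
          \<le> R / P * (u x / A) powr P + R / Q * (v x / B) powr Q"
        using sum1 R P Q by (intro young_powr) auto
      moreover have "((u x / A) powr P) powr (R / P) = (u x / A) powr R"
        "((v x / B) powr Q) powr (R / Q) = (v x / B) powr R"
        using P Q by (auto simp: powr_powr)
      moreover have "(u x / A) powr R * (v x / B) powr R = (u x * v x) powr R / (A * B) powr R"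
        using nn AB by (simp add: powr_mult powr_divide)
      ultimately have "(u x * v x) powr R / (A * B) powr R
          \<le> R / P * (u x / A) powr P + R / Q * (v x / B) powr Q" by simp
      then have "(u x * v x) powr R \<le>
          (R / P * (u x / A) powr P + R / Q * (v x / B) powr Q) * (A * B) powr R"
        using AB by (simp add: pos_divide_le_eq)
      then show ?thesis
        using nn AB by (simp add: powr_divide algebra_simps)
    qed
    define c d where c_def: "c = (A * B) powr R * (R / P / A powr P)"
      and d_def: "d = (A * B) powr R * (R / Q / B powr Q)"
    have cd: "0 \<le> c" "0 \<le> d" using R P Q by (auto simp: c_def d_def)
    have "(\<integral>\<^sup>+ x. ennreal ((u x * v x) powr R) \<partial>M) \<le>
        (\<integral>\<^sup>+ x. ennreal c * ennreal (u x powr P) + ennreal d * ennreal (v x powr Q) \<partial>M)"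
    proof (rule nn_integral_mono)
      fix x
      have "ennreal ((u x * v x) powr R) \<le> ennreal (c * u x powr P + d * v x powr Q)"
        by (intro ennreal_leI) (use pt[of x] in \<open>simp add: c_def d_def\<close>)
      also have "\<dots> = ennreal c * ennreal (u x powr P) + ennreal d * ennreal (v x powr Q)"
        using cd by (simp add: ennreal_plus ennreal_mult)
      finally show "ennreal ((u x * v x) powr R) \<le> \<dots>" .
    qed
    also have "\<dots> = ennreal c * (\<integral>\<^sup>+ x. ennreal (u x powr P) \<partial>M) + ennreal d * (\<integral>\<^sup>+ x. ennreal (v x powr Q) \<partial>M)"
      by (subst nn_integral_add) (auto simp: nn_integral_cmult)
    also have "\<dots> \<le> ennreal c * ennreal (A powr P) + ennreal d * ennreal (B powr Q)"
      by (intro add_mono mult_left_mono u' v') auto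
    also have "\<dots> = ennreal (c * A powr P + d * B powr Q)"
      using cd by (simp add: ennreal_plus ennreal_mult)
    also have "c * A powr P + d * B powr Q = (A * B) powr R * (R / P + R / Q)"
      using AB by (simp add: c_def d_def field_simps)
    finally show ?thesis
      using R sum1 by (simp add: Lp_le_def)
  qed
qed

lemma Lp_le_translate:
  fixes h :: "'a::euclidean_space \<Rightarrow> real"
  assumes [measurable]: "h \<in> borel_measurable borel" and "Lp_le lborel p h B"
  shows "Lp_le lborel p (\<lambda>x. h (x - a)) B"
proof -
  have L: "lborel = distr lborel borel (\<lambda>x. x - a)"
  proof -
    have "(+) (- a) = (\<lambda>x. x - a)" by auto
    then show ?thesis using lborel_distr_plus[of "- a"] by simp
  qed
  show ?thesis
  proof (cases "p = \<infinity>")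
    case True
    have "AE x in distr lborel borel (\<lambda>x. x - a). h x \<le> B"
      using assms(2) True L by (metis Lp_le_def)
    then show ?thesis
      using True by (subst (asm) AE_distr_iff) (auto simp: Lp_le_def)
  next
    case False
    have "(\<integral>\<^sup>+ x. ennreal (h x powr enn2real p) \<partial>lborel)
        = (\<integral>\<^sup>+ x. ennreal (h x powr enn2real p) \<partial>distr lborel borel (\<lambda>x. x - a))"
      using L by metis
    also have "\<dots> = (\<integral>\<^sup>+ x. ennreal (h (x - a) powr enn2real p) \<partial>lborel)"
      by (subst nn_integral_distr) auto
    finally show ?thesis
      using assms(2) False by (simp add: Lp_le_def)
  qed
qed

text \<open>Jensen on \<open>M2\<close> followed by Tonelli gives Minkowski's integral inequality;
  the constants m^(t - 1) from Jensen and m B^t from the mass combine to (m B)^t. The uniform bound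
  K makes the sections integrable, so that the inner integral is not a default 0.\<close>

lemma (in pair_sigma_finite) Lp_le_integral:
  fixes h :: "'a \<times> 'b \<Rightarrow> real"
  assumes [measurable]: "h \<in> borel_measurable (M1 \<Otimes>\<^sub>M M2)"
    and bnd: "\<And>z. 0 \<le> h z" "\<And>z. h z \<le> K"
    and mass: "emeasure M2 (space M2) \<le> ennreal m" "0 < m"
    and p: "1 \<le> p" and B: "0 \<le> B"
    and le: "\<And>\<omega>. Lp_le M1 p (\<lambda>x. h (x, \<omega>)) B"
  shows "Lp_le M1 p (\<lambda>x. \<integral>\<omega>. h (x, \<omega>) \<partial>M2) (m * B)"
proof -
  have fin: "finite_measure M2"
    using mass by (intro finite_measureI) (auto simp: top_unique)
  have ms: "measure M2 (space M2) \<le> m"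
    using mass by (simp add: enn2real_leI measure_def)
  have K: "0 \<le> K" using bnd(1)[of undefined] bnd(2)[of undefined] by linarith
  have int: "integrable M2 (\<lambda>\<omega>. h (x, \<omega>))" if [simp]: "x \<in> space M1" for x
    using bnd by (intro finite_measure.integrable_const_bound[OF fin, of _ K]) auto
  show ?thesis
  proof (cases rule: ennreal_ge_1_cases[OF p])
    case 1
    have "AE \<omega> in M2. AE x in M1. h (x, \<omega>) \<le> B"
      using le 1 by (simp add: Lp_le_def)
    then have "AE x in M1. AE \<omega> in M2. h (x, \<omega>) \<le> B"
      by (subst AE_commute) auto
    then have "AE x in M1. (\<integral>\<omega>. h (x, \<omega>) \<partial>M2) \<le> m * B"
    proof eventually_elim
      case (elim x)
      show ?case
      \<comment> \<open>Membership of x in the space is not at hand here; a non-integrable section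
        has integral 0 by convention.\<close>
      proof (cases "integrable M2 (\<lambda>\<omega>. h (x, \<omega>))")
        case True
        have "(\<integral>\<omega>. h (x, \<omega>) \<partial>M2) \<le> (\<integral>\<omega>. B \<partial>M2)"
          using elim True fin by (intro integral_mono_AE) (auto simp: finite_measure.integrable_const)
        also have "\<dots> \<le> m * B" using ms B by (simp add: mult_right_mono)
        finally show ?thesis .
      qed (use mass B in \<open>simp add: not_integrable_integral_eq\<close>)
    qed
    then show ?thesis using 1 by (simp add: Lp_le_def)
  next
    case 2
    let ?t = "enn2real p"
    define H where "H x = (\<integral>\<omega>. h (x, \<omega>) \<partial>M2)" for x
    have jensen: "ennreal (H x powr ?t) \<le> ennreal (m powr (?t - 1)) * (\<integral>\<^sup>+ \<omega>. ennreal (h (x, \<omega>) powr ?t) \<partial>M2)"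
      if x [simp]: "x \<in> space M1" for x
    proof (cases "H x = 0")
      case False
      \<comment> \<open>The tangent is taken at the mean of h, computed with m in place of the true
        mass of \<open>M2\<close>.\<close>
      define a where "a = H x / m"
      have "0 \<le> H x" unfolding H_def by (intro integral_nonneg_AE) (simp add: bnd)
      then have a: "0 < a" using False mass by (simp add: a_def)
      have int': "integrable M2 (\<lambda>\<omega>. h (x, \<omega>) powr ?t)"
        using bnd 2 by (intro finite_measure.integrable_const_bound[OF fin, of _ "K powr ?t"])
          (auto intro!: powr_mono2)
      \<comment> \<open>The mass \<mu> of \<open>M2\<close> may lie below m. Integrating the tangent
        line gives \<open>a powr t * (\<mu> + t * (m - \<mu>))\<close>, and t \<ge> 1 makes this at
        least \<open>a powr t * m\<close>.\<close>
      have "a powr ?t * m \<le> a powr ?t * (measure M2 (space M2) + ?t * (m - measure M2 (space M2)))"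
      proof (intro mult_left_mono)
        have "1 * (m - measure M2 (space M2)) \<le> ?t * (m - measure M2 (space M2))"
          using 2 ms by (intro mult_right_mono) auto
        then show "m \<le> measure M2 (space M2) + ?t * (m - measure M2 (space M2))" by simp
      qed simp
      also have "\<dots> = a powr ?t * measure M2 (space M2) + ?t * a powr (?t - 1) * (a * m - a * measure M2 (space M2))"
        using a by (simp add: powr_diff field_simps)
      also have "\<dots> = (\<integral>\<omega>. a powr ?t + ?t * a powr (?t - 1) * (h (x, \<omega>) - a) \<partial>M2)"
        using int[OF x] fin mass by (simp add: finite_measure.integrable_const H_def a_def algebra_simps)
      also have "\<dots> \<le> (\<integral>\<omega>. h (x, \<omega>) powr ?t \<partial>M2)"
        using int int' fin a bnd 2 by (intro integral_mono powr_tangent_le) (auto simp: finite_measure.integrable_const)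
      finally have "a powr ?t * m * m powr (?t - 1) \<le> m powr (?t - 1) * (\<integral>\<omega>. h (x, \<omega>) powr ?t \<partial>M2)"
        by (simp add: mult.commute[of _ "m powr (?t - 1)"] mult_left_mono)
      moreover have "a powr ?t * m * m powr (?t - 1) = H x powr ?t"
        using mass \<open>0 \<le> H x\<close> by (simp add: a_def powr_divide powr_diff)
      ultimately have "ennreal (H x powr ?t) \<le> ennreal (m powr (?t - 1)) * ennreal (\<integral>\<omega>. h (x, \<omega>) powr ?t \<partial>M2)"
        by (simp add: ennreal_mult[symmetric] ennreal_leI)
      also have "ennreal (\<integral>\<omega>. h (x, \<omega>) powr ?t \<partial>M2) = (\<integral>\<^sup>+ \<omega>. ennreal (h (x, \<omega>) powr ?t) \<partial>M2)"
        using int' by (intro nn_integral_eq_integral[symmetric]) auto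
      finally show ?thesis .
    qed (use 2 in simp)
    have "(\<integral>\<^sup>+ x. ennreal (H x powr ?t) \<partial>M1)
        \<le> (\<integral>\<^sup>+ x. ennreal (m powr (?t - 1)) * (\<integral>\<^sup>+ \<omega>. ennreal (h (x, \<omega>) powr ?t) \<partial>M2) \<partial>M1)"
      by (intro nn_integral_mono jensen)
    also have "\<dots> = ennreal (m powr (?t - 1)) * (\<integral>\<^sup>+ x. \<integral>\<^sup>+ \<omega>. ennreal (h (x, \<omega>) powr ?t) \<partial>M2 \<partial>M1)"
      by (rule nn_integral_cmult) measurable
    also have "(\<integral>\<^sup>+ x. \<integral>\<^sup>+ \<omega>. ennreal (h (x, \<omega>) powr ?t) \<partial>M2 \<partial>M1)
        = (\<integral>\<^sup>+ \<omega>. \<integral>\<^sup>+ x. ennreal (h (x, \<omega>) powr ?t) \<partial>M1 \<partial>M2)"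
      by (rule Fubini'[symmetric]) measurable
    also have "\<dots> \<le> (\<integral>\<^sup>+ \<omega>. ennreal (B powr ?t) \<partial>M2)"
      using le 2 by (intro nn_integral_mono) (simp add: Lp_le_def)
    also have "\<dots> \<le> ennreal (B powr ?t) * ennreal m"
      using mass by (simp add: mult_left_mono)
    also have "ennreal (m powr (?t - 1)) * (ennreal (B powr ?t) * ennreal m) = ennreal ((m * B) powr ?t)"
      using mass B by (simp add: ennreal_mult[symmetric] powr_mult powr_diff mult_ac)
    finally show ?thesis
      using 2 by (simp add: Lp_le_def H_def mult_left_mono)
  qed
qed

section \<open>Integrals over Euclidean space and the Gaussian\<close>

lemma
  fixes h :: "'a::euclidean_space \<Rightarrow> real \<Rightarrow> 'c::{real_normed_field,banach,second_countable_topology}"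
  assumes int: "\<And>b. b \<in> Basis \<Longrightarrow> integrable lborel (h b)"
  shows integrable_prod_coordinates: "integrable lborel (\<lambda>x. \<Prod>b\<in>Basis. h b (x \<bullet> b))"
    and integral_prod_coordinates:
      "(\<integral>x. (\<Prod>b\<in>Basis. h b (x \<bullet> b)) \<partial>lborel) = (\<Prod>b\<in>Basis. integral\<^sup>L lborel (h b))"
proof -
  interpret product_sigma_finite "\<lambda>_::'a. lborel :: real measure" ..
  let ?T = "\<lambda>f::'a \<Rightarrow> real. \<Sum>b\<in>Basis. f b *\<^sub>R b"
  have meas: "h b \<in> borel_measurable borel" if "b \<in> Basis" for b
    using borel_measurable_integrable[OF int[OF that]] by simp
  have M: "(\<lambda>x. \<Prod>b\<in>Basis. h b (x \<bullet> b)) \<in> borel_measurable borel"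
    by (intro borel_measurable_prod measurable_compose[OF _ meas]) auto
  have T: "?T \<in> measurable (Pi\<^sub>M Basis (\<lambda>_. lborel)) borel"
    by measurable
  have eq: "(\<Prod>b\<in>Basis. h b (?T f \<bullet> b)) = (\<Prod>b\<in>Basis. h b (f b))" for f
    by (intro prod.cong refl) (simp add: inner_sum_left inner_Basis if_distrib cong: if_cong)
  show "integrable lborel (\<lambda>x. \<Prod>b\<in>Basis. h b (x \<bullet> b))"
    using product_integrable_prod[OF finite_Basis int]
    by (subst lborel_eq) (simp add: integrable_distr_eq[OF T M] eq)
  show "(\<integral>x. (\<Prod>b\<in>Basis. h b (x \<bullet> b)) \<partial>lborel) = (\<Prod>b\<in>Basis. integral\<^sup>L lborel (h b))"
    using product_integral_prod[OF finite_Basis int]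
    by (subst lborel_eq) (simp add: integral_distr[OF T M] eq)
qed

text \<open>Comparison with the product over the coordinates of 1 / (1 + t^2). With n the dimension,
  the reciprocal of that product is at most (1 + |x|^2)^n \<le> 2^n (1 + |x|^(2 n)), so the decay
  bounds of orders 0 and 2 n yield the constant C.\<close>

lemma integrable_rapid_decay:
  fixes h :: "'a::euclidean_space \<Rightarrow> complex"
  assumes h: "h \<in> borel_measurable borel"
    and decay: "\<And>N::nat. \<exists>B. \<forall>x. norm x ^ N * norm (h x) \<le> B"
  shows "integrable lborel h"
proof -
  let ?n = "DIM('a)"
  obtain B0 where B0: "norm (h x) \<le> B0" for x
    using decay[of 0] by auto
  obtain B where B: "norm x ^ (2 * ?n) * norm (h x) \<le> B" for x
    using decay by blast
  define C where "C = 2 ^ ?n * (B0 + B)"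
  have "integrable lborel (\<lambda>x::real. inverse (1 + x^2))"
    using integrable_inverse_1_plus_square by (simp add: set_integrable_def)
  then have I: "integrable lborel (\<lambda>x::'a. \<Prod>b\<in>Basis. inverse (1 + (x \<bullet> b)\<^sup>2))"
    by (rule integrable_prod_coordinates)
  have bound: "norm (h x) \<le> norm (C * (\<Prod>b\<in>Basis. inverse (1 + (x \<bullet> b)\<^sup>2)))" for x
  proof -
    have "(1 + (x \<bullet> b)\<^sup>2) \<le> 1 + (norm x)\<^sup>2" if "b \<in> Basis" for b
      using Basis_le_norm[OF that, of x] by (simp add: abs_le_square_iff[symmetric])
    then have "(\<Prod>b\<in>Basis. (1 + (x \<bullet> b)\<^sup>2)) \<le> (\<Prod>b\<in>(Basis::'a set). 1 + (norm x)\<^sup>2)"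
      by (intro prod_mono) auto
    also have "\<dots> = (1 + (norm x)\<^sup>2) ^ ?n" by simp
    also have "\<dots> \<le> (2 * max 1 ((norm x)\<^sup>2)) ^ ?n"
      by (intro power_mono) auto
    also have "\<dots> = 2 ^ ?n * max 1 ((norm x)\<^sup>2) ^ ?n"
      by (rule power_mult_distrib)
    also have "max 1 ((norm x)\<^sup>2) ^ ?n \<le> 1 + norm x ^ (2 * ?n)"
      by (auto simp: max_def power_mult)
    finally have "(\<Prod>b\<in>Basis. (1 + (x \<bullet> b)\<^sup>2)) * norm (h x) \<le> 2 ^ ?n * (1 + norm x ^ (2 * ?n)) * norm (h x)"
      by (simp add: mult_right_mono)
    also have "\<dots> = 2 ^ ?n * (norm (h x) + norm x ^ (2 * ?n) * norm (h x))"
      by (simp add: algebra_simps)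
    also have "\<dots> \<le> C"
      unfolding C_def by (intro mult_left_mono add_mono B0 B) auto
    finally have *: "(\<Prod>b\<in>Basis. (1 + (x \<bullet> b)\<^sup>2)) * norm (h x) \<le> C" .
    have pos: "0 < (\<Prod>b\<in>Basis. (1 + (x \<bullet> b)\<^sup>2))"
      by (intro prod_pos) (auto simp: add_pos_nonneg)
    then have "norm (h x) \<le> C * inverse (\<Prod>b\<in>Basis. (1 + (x \<bullet> b)\<^sup>2))"
      using * by (simp add: field_simps)
    also have "\<dots> = C * (\<Prod>b\<in>Basis. inverse (1 + (x \<bullet> b)\<^sup>2))"
      by (simp add: prod_inversef[symmetric])
    finally show ?thesis by simp
  qed
  show ?thesis
    by (rule Bochner_Integration.integrable_bound[OF integrable_mult_right[OF I]])
      (use h bound in auto)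
qed

section \<open>The standard Gaussian\<close>

definition gauss :: "'a::euclidean_space \<Rightarrow> real" where
  "gauss x = (\<Prod>b\<in>Basis. std_normal_density (x \<bullet> b))"

lemma gauss_eq: "gauss (x::'a::euclidean_space) = (1 / sqrt (2 * pi)) ^ DIM('a) * exp (- (norm x)\<^sup>2 / 2)"
proof -
  have "(norm x)\<^sup>2 = (\<Sum>b\<in>Basis. (x \<bullet> b)\<^sup>2)"
    by (simp add: norm_eq_sqrt_inner euclidean_inner[of x x] power2_eq_square sum_nonneg)
  then have "exp (- (norm x)\<^sup>2 / 2) = (\<Prod>b\<in>Basis. exp (- (x \<bullet> b)\<^sup>2 / 2))"
    by (simp add: exp_sum[symmetric] sum_negf sum_divide_distrib)
  then show ?thesis
    by (simp only: gauss_def std_normal_density_def prod.distrib prod_constant)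
qed

lemma gauss_pos: "0 < gauss x"
  by (simp add: gauss_eq)

lemma gauss_measurable [measurable]: "gauss \<in> borel_measurable borel"
  unfolding gauss_def by measurable

lemma
  shows integrable_gauss: "integrable lborel (gauss :: 'a::euclidean_space \<Rightarrow> real)"
    and integral_gauss: "integral\<^sup>L lborel (gauss :: 'a \<Rightarrow> real) = 1"
proof -
  have [simp]: "integrable lborel std_normal_density" by simp
  show "integrable lborel (gauss :: 'a \<Rightarrow> real)"
    using integrable_prod_coordinates[of "\<lambda>_::'a. std_normal_density"] by (simp add: gauss_def[abs_def])
  show "integral\<^sup>L lborel (gauss :: 'a \<Rightarrow> real) = 1"
    using integral_prod_coordinates[of "\<lambda>_::'a. std_normal_density"] by (simp add: gauss_def[abs_def])
qed

lemma cis_measurable [measurable]: "cis \<in> borel_measurable borel"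
  by (intro borel_measurable_continuous_onI continuous_intros)

lemma integrable_mult_cis:
  fixes h :: "'a \<Rightarrow> complex"
  assumes "integrable M h" "\<theta> \<in> borel_measurable M"
  shows "integrable M (\<lambda>x. h x * cis (\<theta> x))"
proof (rule Bochner_Integration.integrable_bound[OF assms(1)])
  show "(\<lambda>x. h x * cis (\<theta> x)) \<in> borel_measurable M"
    using assms by auto
qed (simp add: norm_mult)

text \<open>The product form of \<open>gauss\<close> reduces this to the characteristic function of
  the standard normal law. Its unit variance does not match the 2 pi in \<open>fourier\<close>,
  which is the source of the factors 2 pi and 2 pi^2 further on.\<close>

lemma fourier_gauss:
  fixes v :: "'a::euclidean_space"
  shows "(\<integral>z. of_real (gauss z) * cis (z \<bullet> v) \<partial>lborel) = complex_of_real (exp (- (norm v)\<^sup>2 / 2))"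
proof -
  let ?h = "\<lambda>b x. complex_of_real (std_normal_density x) * cis (x * (v \<bullet> b))"
  have int: "integrable lborel (?h b)" for b :: 'a
    by (intro integrable_mult_cis integrable_of_real) auto
  have one: "integral\<^sup>L lborel (?h b) = complex_of_real (exp (- (v \<bullet> b)\<^sup>2 / 2))" for b :: 'a
  proof -
    have "integral\<^sup>L lborel (?h b) = char std_normal_distribution (v \<bullet> b)"
      unfolding char_def
      by (subst integral_density) (auto simp: scaleR_conv_of_real cis_conv_exp mult_ac)
    then show ?thesis by (simp add: char_std_normal_distribution)
  qed
  have "complex_of_real (gauss z) * cis (z \<bullet> v) = (\<Prod>b\<in>Basis. ?h b (z \<bullet> b))" for z
  proof -
    have "cis (z \<bullet> v) = (\<Prod>b\<in>Basis. cis ((z \<bullet> b) * (v \<bullet> b)))"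
      by (simp add: euclidean_inner[of z v] cis_conv_exp sum_distrib_left exp_sum[symmetric])
    then show ?thesis by (simp add: gauss_def prod.distrib)
  qed
  then have "(\<integral>z. complex_of_real (gauss z) * cis (z \<bullet> v) \<partial>lborel) = (\<Prod>b\<in>Basis. integral\<^sup>L lborel (?h b))"
    using integral_prod_coordinates[of ?h] int by simp
  also have "\<dots> = complex_of_real (\<Prod>b\<in>Basis. exp (- (v \<bullet> b)\<^sup>2 / 2))"
    by (simp add: one)
  also have "(\<Prod>b\<in>Basis. exp (- (v \<bullet> b)\<^sup>2 / 2)) = exp (- (norm v)\<^sup>2 / 2)"
    by (simp add: exp_sum[symmetric] sum_negf sum_divide_distrib[symmetric]
        norm_eq_sqrt_inner euclidean_inner[of v v] power2_eq_square sum_nonneg)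
  finally show ?thesis by simp
qed

lemma
  fixes h :: "'a::euclidean_space \<Rightarrow> 'b::{banach,second_countable_topology}"
  shows integrable_translate: "integrable lborel h \<Longrightarrow> integrable lborel (\<lambda>x. h (x + a))"
    and integral_translate: "h \<in> borel_measurable borel \<Longrightarrow> (\<integral>x. h (x + a) \<partial>lborel) = (\<integral>x. h x \<partial>lborel)"
proof -
  have "(+) a = (\<lambda>x. x + a)" by (simp add: fun_eq_iff add.commute)
  then have L: "lborel = distr lborel borel (\<lambda>x. x + a)"
    using lborel_distr_plus[of a] by simp
  show "integrable lborel (\<lambda>x. h (x + a))" if "integrable lborel h"
  proof -
    have "integrable (distr lborel borel (\<lambda>x. x + a)) h"
      using that L by metis
    then show ?thesis
      using borel_measurable_integrable[OF that] by (simp add: integrable_distr_eq)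
  qed
  show "(\<integral>x. h (x + a) \<partial>lborel) = (\<integral>x. h x \<partial>lborel)" if "h \<in> borel_measurable borel"
    using that by (subst (2) L) (simp add: integral_distr)
qed

lemma integral_affine:
  fixes h :: "'a::euclidean_space \<Rightarrow> 'b::{banach,second_countable_topology}"
  assumes "c \<noteq> 0" "h \<in> borel_measurable borel"
  shows "(\<integral>x. h x \<partial>lborel) = \<bar>c\<bar> ^ DIM('a) *\<^sub>R (\<integral>x. h (t + c *\<^sub>R x) \<partial>lborel)"
  using assms(2) by (subst lborel_affine[OF assms(1), of t]) (simp add: integral_density integral_distr)

text \<open>Two bounds are combined: 2, from the two unit masses, and 2 |w| + |w| / 8, from writing
  the densities as squares a^2 and b^2. The integral of (a - b)^2, a squared Hellinger distance, is
  of order |w|^2.\<close>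

lemma integral_gauss_modulus:
  fixes w :: "'a::euclidean_space"
  shows "(\<integral>\<^sup>+ z. ennreal \<bar>gauss z - gauss (z - w)\<bar> \<partial>lborel) \<le> ennreal (3 * min 1 (norm w))"
proof -
  have ig: "integrable lborel (gauss :: 'a \<Rightarrow> real)" and ig1: "integral\<^sup>L lborel (gauss :: 'a \<Rightarrow> real) = 1"
    by (rule integrable_gauss integral_gauss)+
  have int: "integrable lborel (\<lambda>z. gauss (z - v))" for v :: 'a
    using integrable_translate[OF integrable_gauss, of "- v"] by simp
  have I1: "(\<integral>z. gauss (z - v) \<partial>lborel) = 1" for v :: 'a
    using integral_translate[of gauss "- v"] ig1 by simp
  have intd: "integrable lborel (\<lambda>z. \<bar>gauss z - gauss (z - w)\<bar>)"
    using Bochner_Integration.integrable_diff[OF integrable_gauss int, of w] by (rule integrable_abs)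
  have "(\<integral>z. \<bar>gauss z - gauss (z - w)\<bar> \<partial>lborel) \<le> (\<integral>z. gauss z + gauss (z - w) \<partial>lborel)"
    using ig int
    by (intro integral_mono intd) (auto intro!: abs_triangle_ineq4[THEN order_trans] simp: gauss_pos less_imp_le)
  also have "\<dots> = 2" using ig int I1 ig1 by simp
  finally have b2: "(\<integral>z. \<bar>gauss z - gauss (z - w)\<bar> \<partial>lborel) \<le> 2" .
  have b3: "(\<integral>z. \<bar>gauss z - gauss (z - w)\<bar> \<partial>lborel) \<le> 3 * norm w" if "w \<noteq> 0"
  proof -
    let ?d = "norm w"
    have d: "0 < ?d" using that by simp
    define \<rho> where "\<rho> = exp (- ?d\<^sup>2 / 8)"
    text \<open>AM-GM for \<open>|a\<^sup>2 - b\<^sup>2| = |a - b| (a + b)\<close> with \<open>a\<close>, \<open>b\<close> the square roots of the two Gaussians; the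
      cross term \<open>a b\<close> is again a Gaussian, so no derivative of the density is needed.\<close>
    have root: "sqrt (gauss z) * sqrt (gauss (z - w)) = \<rho> * gauss (z - (1/2) *\<^sub>R w)" for z
    proof -
      have *: "(norm z)\<^sup>2 + (norm (z - w))\<^sup>2 = 2 * (norm (z - (1/2) *\<^sub>R w))\<^sup>2 + ?d\<^sup>2 / 2"
        by (simp add: power2_norm_eq_inner inner_diff_left inner_diff_right inner_commute algebra_simps)
      have "(sqrt (gauss z) * sqrt (gauss (z - w)))\<^sup>2 = gauss z * gauss (z - w)"
        by (simp add: power_mult_distrib gauss_pos less_imp_le)
      also have "\<dots> = ((1 / sqrt (2 * pi)) ^ DIM('a))\<^sup>2 * exp (- ((norm z)\<^sup>2 + (norm (z - w))\<^sup>2) / 2)"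
        by (simp add: gauss_eq power2_eq_square exp_add[symmetric] add_divide_distrib diff_divide_distrib)
      also have "\<dots> = (\<rho> * gauss (z - (1/2) *\<^sub>R w))\<^sup>2"
        unfolding * by (simp add: gauss_eq \<rho>_def power2_eq_square exp_add[symmetric] field_simps)
      finally show ?thesis
        by (subst (asm) power2_eq_iff_nonneg) (auto simp: gauss_pos less_imp_le \<rho>_def)
    qed
    have pt: "\<bar>gauss z - gauss (z - w)\<bar>
        \<le> (1 / (2 * ?d)) * (gauss z + gauss (z - w) - 2 * (\<rho> * gauss (z - (1/2) *\<^sub>R w)))
          + ?d * (gauss z + gauss (z - w))" for z
    proof -
      define a b where "a = sqrt (gauss z)" and "b = sqrt (gauss (z - w))"
      have ab: "gauss z = a\<^sup>2" "gauss (z - w) = b\<^sup>2" "0 \<le> a" "0 \<le> b"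
        by (auto simp: a_def b_def gauss_pos less_imp_le)
      \<comment> \<open>The weights balance the two terms: (a - b)^2 integrates to order |w|^2 and
        (a + b)^2 to order 1, so both contributions become of order |w|.\<close>
      have "0 \<le> (\<bar>a - b\<bar> / sqrt ?d - sqrt ?d * (a + b))\<^sup>2" by simp
      also have "\<dots> = (\<bar>a - b\<bar>)\<^sup>2 / ?d - 2 * (\<bar>a - b\<bar> * (a + b)) + ?d * (a + b)\<^sup>2"
        using d by (simp add: power2_diff power_divide power_mult_distrib)
      finally have "\<bar>a - b\<bar> * (a + b) \<le> (a - b)\<^sup>2 / (2 * ?d) + ?d * (a + b)\<^sup>2 / 2"
        by (simp add: field_simps)
      also have "(a + b)\<^sup>2 / 2 \<le> a\<^sup>2 + b\<^sup>2"
        using sum_squares_bound[of a b] by (simp add: power2_sum)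
      then have "?d * (a + b)\<^sup>2 / 2 \<le> ?d * (a\<^sup>2 + b\<^sup>2)"
        using d by simp
      also have "\<bar>a - b\<bar> * (a + b) = \<bar>a\<^sup>2 - b\<^sup>2\<bar>"
        using ab by (simp add: power2_eq_square square_diff_square_factored abs_mult)
      finally show ?thesis
        using root[of z, folded a_def b_def, symmetric] unfolding ab(1,2)
        by (simp add: power2_diff mult.assoc)
    qed
    have "(\<integral>z. \<bar>gauss z - gauss (z - w)\<bar> \<partial>lborel)
        \<le> (\<integral>z. (1 / (2 * ?d)) * (gauss z + gauss (z - w) - 2 * (\<rho> * gauss (z - (1/2) *\<^sub>R w)))
          + ?d * (gauss z + gauss (z - w)) \<partial>lborel)"
      by (intro integral_mono intd pt Bochner_Integration.integrable_add Bochner_Integration.integrable_diff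
          integrable_mult_right ig int)
    also have "\<dots> = (1 / (2 * ?d)) * (2 - 2 * \<rho>) + ?d * 2"
      using ig int[of w] int[of "(1/2) *\<^sub>R w"] I1[of w] I1[of "(1/2) *\<^sub>R w"] ig1 by simp
    \<comment> \<open>The left side is the integral of (a - b)^2; the inequality 1 - exp (- t) \<le>
      t bounds it.\<close>
    also have "2 - 2 * \<rho> \<le> ?d\<^sup>2 / 4"
      using exp_ge_add_one_self[of "- ?d\<^sup>2 / 8"] by (simp add: \<rho>_def)
    then have "(1 / (2 * ?d)) * (2 - 2 * \<rho>) \<le> (1 / (2 * ?d)) * (?d\<^sup>2 / 4)"
      using d by (intro mult_left_mono) auto
    also have "(1 / (2 * ?d)) * (?d\<^sup>2 / 4) = ?d / 8"
      using d by (simp add: power2_eq_square)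
    finally show ?thesis using d by linarith
  qed
  have "(\<integral>z. \<bar>gauss z - gauss (z - w)\<bar> \<partial>lborel) \<le> 3 * min 1 (norm w)"
    using b2 b3 by (cases "w = 0") (auto simp: min_def)
  then show ?thesis
    using nn_integral_eq_integral[OF intd] by (simp add: ennreal_leI)
qed

text \<open>Split at \<tau> = a: the minimum is at most 1 below and at most a / \<tau> above. The
  part near 0 converges since s > 0 and gives a^s / s; the tail converges since s < 1 and gives a^s
  / (1 - s).\<close>

lemma nn_integral_powr_min:
  fixes s a :: real
  assumes "0 < s" "s < 1" "0 < a"
  shows "(\<integral>\<^sup>+ \<tau>. ennreal (\<tau> powr (s - 1) * min 1 (a / \<tau>)) * indicator {0<..} \<tau> \<partial>lborel)
    \<le> ennreal (a powr s * (1 / s + 1 / (1 - s)))"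
proof -
  have "(\<integral>\<^sup>+ \<tau>. ennreal (\<tau> powr (s - 1) * min 1 (a / \<tau>)) * indicator {0<..} \<tau> \<partial>lborel)
      \<le> (\<integral>\<^sup>+ \<tau>. ennreal (\<tau> powr (s - 1)) * indicator {0..a} \<tau>
            + ennreal (a * \<tau> powr (s - 2)) * indicator {a..} \<tau> \<partial>lborel)"
  proof (rule nn_integral_mono)
    fix \<tau> :: real
    have "\<tau> powr (s - 1) * min 1 (a / \<tau>) \<le> a * \<tau> powr (s - 2)" if "a \<le> \<tau>"
    proof -
      have "\<tau> powr (s - 1) * min 1 (a / \<tau>) \<le> \<tau> powr (s - 1) * (a / \<tau>)"
        by (intro mult_left_mono) auto
      also have "\<dots> = a * \<tau> powr (s - 2)"
        using that assms by (simp add: powr_diff power2_eq_square)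
      finally show ?thesis .
    qed
    moreover have "\<tau> powr (s - 1) * min 1 (a / \<tau>) \<le> \<tau> powr (s - 1)"
      using mult_left_mono[of "min 1 (a / \<tau>)" 1 "\<tau> powr (s - 1)"] by simp
    ultimately show "ennreal (\<tau> powr (s - 1) * min 1 (a / \<tau>)) * indicator {0<..} \<tau>
        \<le> ennreal (\<tau> powr (s - 1)) * indicator {0..a} \<tau> + ennreal (a * \<tau> powr (s - 2)) * indicator {a..} \<tau>"
      using assms by (cases "\<tau> \<le> a") (auto simp: indicator_def intro!: ennreal_leI add_increasing2)
  qed
  also have "\<dots> = ennreal (a powr s / s) + ennreal (a * (a powr (s - 1) / (1 - s)))"
  proof (subst nn_integral_add)
    have "((\<lambda>\<tau>. \<tau> powr (s - 1)) has_integral (a powr s / s)) {0..a}"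
      using has_integral_powr_from_0[of "s - 1" a] assms by simp
    then have 1: "(\<integral>\<^sup>+ \<tau>. ennreal (\<tau> powr (s - 1)) * indicator {0..a} \<tau> \<partial>lborel) = ennreal (a powr s / s)"
      by (intro nn_integral_has_integral_lebesgue') auto
    have "((\<lambda>\<tau>. \<tau> powr (s - 2)) has_integral (a powr (s - 1) / (1 - s))) {a..}"
    proof -
      have "- (a powr (s - 1)) / (s - 1) = a powr (s - 1) / (1 - s)"
        by (metis minus_diff_eq minus_divide_divide)
      then show ?thesis
        using has_integral_powr_to_inf[of "s - 2" a] assms by simp
    qed
    from has_integral_mult_right[OF this, of a]
    have 2: "(\<integral>\<^sup>+ \<tau>. ennreal (a * \<tau> powr (s - 2)) * indicator {a..} \<tau> \<partial>lborel) = ennreal (a * (a powr (s - 1) / (1 - s)))"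
      using assms by (intro nn_integral_has_integral_lebesgue') auto
    show "(\<integral>\<^sup>+ \<tau>. ennreal (\<tau> powr (s - 1)) * indicator {0..a} \<tau> \<partial>lborel)
        + (\<integral>\<^sup>+ \<tau>. ennreal (a * \<tau> powr (s - 2)) * indicator {a..} \<tau> \<partial>lborel)
        = ennreal (a powr s / s) + ennreal (a * (a powr (s - 1) / (1 - s)))"
      by (simp only: 1 2)
  qed auto
  also have "\<dots> = ennreal (a powr s / s + a * (a powr (s - 1) / (1 - s)))"
    using assms by (simp add: ennreal_plus)
  also have "a powr s / s + a * (a powr (s - 1) / (1 - s)) = a powr s * (1 / s + 1 / (1 - s))"
    using assms by (simp add: powr_diff distrib_left)
  finally show ?thesis .
qed

section \<open>The Fourier transform of Schwartz functions\<close>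

text \<open>For non-integrable f the left side is 0 by the convention for Bochner integrals. Later
  estimates can thus move a norm inside an integral before integrability is known.\<close>

lemma norm_integral_le_nn:
  fixes f :: "'b \<Rightarrow> 'c::{banach,second_countable_topology}"
  shows "ennreal (norm (integral\<^sup>L M f)) \<le> (\<integral>\<^sup>+ x. ennreal (norm (f x)) \<partial>M)"
  by (cases "integrable M f") (simp_all add: integral_norm_bound_ennreal not_integrable_integral_eq)

text \<open>Leaving the completed measure makes Fubini on
  \<open>lborel \<Otimes>\<^sub>M lborel\<close> and Borel measurability of the transform
  available.\<close>

lemma fourier_lborel:
  assumes "h \<in> borel_measurable borel"
  shows "fourier h \<xi> = (\<integral>x. h x * cis (- 2 * pi * (x \<bullet> \<xi>)) \<partial>lborel)"
  using assms unfolding fourier_def by (intro integral_completion) auto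

lemma inverse_fourier_lborel:
  assumes "h \<in> borel_measurable borel"
  shows "inverse_fourier h x = (\<integral>\<xi>. h \<xi> * cis (2 * pi * (x \<bullet> \<xi>)) \<partial>lborel)"
  using assms unfolding inverse_fourier_def by (intro integral_completion) auto

lemma fourier_measurable [measurable]:
  assumes [measurable]: "h \<in> borel_measurable borel"
  shows "fourier h \<in> borel_measurable borel"
  unfolding fourier_lborel[OF assms, abs_def] by measurable

lemma inverse_fourier_measurable [measurable]:
  assumes [measurable]: "h \<in> borel_measurable borel"
  shows "inverse_fourier h \<in> borel_measurable borel"
  unfolding inverse_fourier_lborel[OF assms, abs_def] by measurable

lemma norm_fourier_le:
  assumes "integrable lborel h"
  shows "norm (fourier h \<xi>) \<le> (\<integral>x. norm (h x) \<partial>lborel)"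
proof -
  have [measurable]: "h \<in> borel_measurable borel" using assms by (auto dest: borel_measurable_integrable)
  show ?thesis
    unfolding fourier_lborel[OF \<open>h \<in> borel_measurable borel\<close>]
    using integral_norm_bound[of lborel "\<lambda>x. h x * cis (- 2 * pi * (x \<bullet> \<xi>))"] by (simp add: norm_mult)
qed

lemma norm_inverse_fourier_le:
  assumes "integrable lborel h"
  shows "norm (inverse_fourier h x) \<le> (\<integral>\<xi>. norm (h \<xi>) \<partial>lborel)"
proof -
  have [measurable]: "h \<in> borel_measurable borel" using assms by (auto dest: borel_measurable_integrable)
  show ?thesis
    unfolding inverse_fourier_lborel[OF \<open>h \<in> borel_measurable borel\<close>]
    using integral_norm_bound[of lborel "\<lambda>\<xi>. h \<xi> * cis (2 * pi * (x \<bullet> \<xi>))"] by (simp add: norm_mult)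
qed

section \<open>Schwartz functions and the decay of their transforms\<close>

lemma schwartz_differentiable: "f \<in> schwartz \<Longrightarrow> f differentiable (at x)"
  unfolding schwartz_def iter_partial_deriv_def by (auto dest: spec[of _ "[]"])

lemma schwartz_decay: "f \<in> schwartz \<Longrightarrow> \<exists>B. \<forall>x. norm x ^ N * norm (f x) \<le> B"
  unfolding schwartz_def iter_partial_deriv_def by (auto dest: spec[of _ "[]"])

lemma schwartz_partial_deriv:
  assumes "f \<in> schwartz" "b \<in> Basis"
  shows "partial_deriv b f \<in> schwartz"
proof -
  \<comment> \<open>\<open>foldr\<close> applies the last entry of the list first.\<close>
  have "iter_partial_deriv bs (partial_deriv b f) = iter_partial_deriv (bs @ [b]) f" for bs
    by (simp add: iter_partial_deriv_def)
  then show ?thesis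
    using assms by (auto simp: schwartz_def)
qed

lemma schwartz_continuous: "f \<in> schwartz \<Longrightarrow> continuous_on UNIV f"
  by (intro differentiable_imp_continuous_on)
    (auto simp: differentiable_on_def schwartz_differentiable intro: differentiable_at_withinI)

lemma schwartz_measurable [measurable_dest]: "f \<in> schwartz \<Longrightarrow> f \<in> borel_measurable borel"
  by (intro borel_measurable_continuous_onI schwartz_continuous)

lemma schwartz_bounded:
  assumes "f \<in> schwartz"
  obtains B where "0 \<le> B" "\<And>x. norm (f x) \<le> B"
proof -
  obtain B where "norm (f x) \<le> B" for x
    using schwartz_decay[OF assms, of 0] by auto
  then show ?thesis
    using that[of "max 0 B"] by (simp add: le_max_iff_disj)
qed

lemma schwartz_integrable: "f \<in> schwartz \<Longrightarrow> integrable lborel f"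
  by (intro integrable_rapid_decay schwartz_measurable schwartz_decay)

text \<open>Translation invariance replaces boundary terms at infinity: the integral of h(x + b) -
  h(x) vanishes, and writing this difference as the integral of g(x + u b) over u in [0, 1] turns
  it, by Fubini, into the integral of g.\<close>

lemma integral_directional_derivative:
  fixes h g :: "'a::euclidean_space \<Rightarrow> complex"
  assumes deriv: "\<And>x u. ((\<lambda>u. h (x + u *\<^sub>R b)) has_vector_derivative g (x + u *\<^sub>R b)) (at u)"
    and cont: "continuous_on UNIV g" and h: "integrable lborel h" and g: "integrable lborel g"
  shows "integral\<^sup>L lborel g = 0"
proof -
  have [measurable]: "g \<in> borel_measurable borel" "h \<in> borel_measurable borel"
    using g h by (auto dest: borel_measurable_integrable)
  let ?k = "\<lambda>(u, x). indicator {0..1} u *\<^sub>R g (x + u *\<^sub>R b)"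
  have int: "integrable (lborel \<Otimes>\<^sub>M lborel) ?k"
  proof (rule lborel_pair.Fubini_integrable)
    have "(\<lambda>u. \<integral>x. norm (?k (u, x)) \<partial>lborel) = (\<lambda>u. indicator {0..1} u * (\<integral>x. norm (g x) \<partial>lborel))"
      using integral_translate[of "\<lambda>x. norm (g x)"] by (simp add: fun_eq_iff)
    then show "integrable lborel (\<lambda>u::real. \<integral>x. norm (?k (u, x)) \<partial>lborel)"
      by simp
    show "AE u in lborel. integrable lborel (\<lambda>x. ?k (u, x))"
      using integrable_translate[OF g] by auto
  qed measurable
  have FTC: "(\<integral>u. indicator {0..1} u *\<^sub>R g (x + u *\<^sub>R b) \<partial>lborel) = h (x + b) - h x" for x
  proof -
    have "(\<integral>u. indicator {0..1} u *\<^sub>R g (x + u *\<^sub>R b) \<partial>lborel) = h (x + 1 *\<^sub>R b) - h (x + 0 *\<^sub>R b)"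
      by (intro integral_FTC_Icc has_vector_derivative_at_within[OF deriv]
            continuous_on_compose2[OF cont] continuous_intros) auto
    then show ?thesis by simp
  qed
  have "0 = (\<integral>x. h (x + b) - h x \<partial>lborel)"
    using integral_translate[of h b] integrable_translate[OF h] h by simp
  also have "\<dots> = (\<integral>x. (\<integral>u. indicator {0..1} u *\<^sub>R g (x + u *\<^sub>R b) \<partial>lborel) \<partial>lborel)"
    by (simp add: FTC)
  also have "\<dots> = (\<integral>u. (\<integral>x. indicator {0..1} u *\<^sub>R g (x + u *\<^sub>R b) \<partial>lborel) \<partial>lborel)"
    using lborel_pair.Fubini_integral[OF int] by simp
  also have "\<dots> = (\<integral>u. indicator {0..1::real} u *\<^sub>R integral\<^sup>L lborel g \<partial>lborel)"
    using integral_translate[of g] by simp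
  also have "\<dots> = integral\<^sup>L lborel g"
    by simp
  finally show ?thesis by simp
qed

text \<open>Integration by parts: the b-derivative of f times the character has integral 0, and the
  term in which the character is differentiated contributes -2 pi i (\<xi> \<bullet> b) times the
  transform.\<close>

lemma fourier_partial_deriv:
  assumes f: "f \<in> schwartz" and b: "b \<in> Basis"
  shows "fourier (partial_deriv b f) \<xi> = 2 * pi * \<i> * (\<xi> \<bullet> b) * fourier f \<xi>"
proof -
  let ?e = "\<lambda>x. cis (- 2 * pi * (x \<bullet> \<xi>))"
  let ?c = "- 2 * pi * (\<xi> \<bullet> b) :: real"
  note [measurable] = schwartz_measurable[OF f] schwartz_measurable[OF schwartz_partial_deriv[OF f b]]
  have intf: "integrable lborel (\<lambda>x. f x * ?e x)"
    by (intro integrable_mult_cis schwartz_integrable f) measurable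
  have intp: "integrable lborel (\<lambda>x. partial_deriv b f x * ?e x)"
    by (intro integrable_mult_cis schwartz_integrable schwartz_partial_deriv f b) measurable
  let ?g = "\<lambda>x. partial_deriv b f x * ?e x + \<i> * ?c * (f x * ?e x)"
  have "integral\<^sup>L lborel ?g = 0"
  proof (rule integral_directional_derivative)
    fix x u
    have "(f has_derivative frechet_derivative f (at (x + u *\<^sub>R b))) (at (x + u *\<^sub>R b))"
      using schwartz_differentiable[OF f] by (simp add: frechet_derivative_works[symmetric])
    then have "((\<lambda>u. f (x + u *\<^sub>R b)) has_derivative (\<lambda>v. frechet_derivative f (at (x + u *\<^sub>R b)) (v *\<^sub>R b))) (at u)"
      by (rule has_derivative_compose[rotated]) (auto intro!: derivative_eq_intros)
    moreover have "linear (frechet_derivative f (at (x + u *\<^sub>R b)))"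
      using schwartz_differentiable[OF f] linear_frechet_derivative by blast
    ultimately have d1: "((\<lambda>u. f (x + u *\<^sub>R b)) has_vector_derivative partial_deriv b f (x + u *\<^sub>R b)) (at u)"
      by (simp add: has_vector_derivative_def partial_deriv_def linear_cmul)
    have "((\<lambda>u. - 2 * pi * ((x + u *\<^sub>R b) \<bullet> \<xi>)) has_derivative (\<lambda>t. t * ?c)) (at u)"
      by (auto intro!: derivative_eq_intros ext simp: inner_commute)
    then have d2: "((\<lambda>u. ?e (x + u *\<^sub>R b)) has_vector_derivative ?e (x + u *\<^sub>R b) * (\<i> * ?c)) (at u)"
      unfolding has_vector_derivative_def
      by (rule has_derivative_eq_rhs[OF has_derivative_cis])
        (simp add: scaleR_conv_of_real fun_eq_iff mult_ac)
    show "((\<lambda>u. f (x + u *\<^sub>R b) * ?e (x + u *\<^sub>R b)) has_vector_derivative ?g (x + u *\<^sub>R b)) (at u)"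
      using has_vector_derivative_mult[OF d1 d2] by (simp add: algebra_simps)
  next
    show "continuous_on UNIV ?g"
      by (intro continuous_intros schwartz_continuous schwartz_partial_deriv f b)
  qed (use intf intp in simp_all)
  moreover have "integral\<^sup>L lborel ?g = fourier (partial_deriv b f) \<xi> + \<i> * ?c * fourier f \<xi>"
    using intf intp by (simp add: fourier_lborel)
  ultimately show ?thesis
    by (simp add: algebra_simps add_eq_0_iff)
qed

text \<open>One power of |\<xi>| is dominated by the sum of the coordinates, and each coordinate is
  traded for a partial derivative of f; hence the induction on N over all f at once.\<close>

lemma fourier_schwartz_decay:
  assumes "f \<in> schwartz"
  shows "\<exists>B. \<forall>\<xi>. norm \<xi> ^ N * norm (fourier f \<xi>) \<le> B"
  using assms
proof (induction N arbitrary: f)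
  case 0
  then show ?case using norm_fourier_le[OF schwartz_integrable] by auto
next
  case (Suc N)
  have "\<forall>b\<in>Basis. \<exists>B. \<forall>\<xi>. norm \<xi> ^ N * norm (fourier (partial_deriv b f) \<xi>) \<le> B"
    using Suc schwartz_partial_deriv by blast
  then obtain B where B: "norm \<xi> ^ N * norm (fourier (partial_deriv b f) \<xi>) \<le> B b" if "b \<in> Basis" for b \<xi>
    by metis
  have "norm \<xi> ^ Suc N * norm (fourier f \<xi>) \<le> (\<Sum>b\<in>Basis. B b)" for \<xi>
  proof -
    have "norm \<xi> ^ Suc N * norm (fourier f \<xi>) = norm \<xi> * (norm \<xi> ^ N * norm (fourier f \<xi>))"
      by simp
    also have "\<dots> \<le> (\<Sum>b\<in>Basis. \<bar>\<xi> \<bullet> b\<bar>) * (norm \<xi> ^ N * norm (fourier f \<xi>))"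
      by (intro mult_right_mono norm_le_l1) auto
    also have "\<dots> = (\<Sum>b\<in>Basis. norm \<xi> ^ N * (\<bar>\<xi> \<bullet> b\<bar> * norm (fourier f \<xi>)))"
      by (simp add: sum_distrib_right sum_distrib_left mult_ac)
    also have "\<dots> \<le> (\<Sum>b\<in>Basis. B b)"
    proof (intro sum_mono)
      fix b :: 'a assume b: "b \<in> Basis"
      \<comment> \<open>Differentiation produces a factor 2 pi, which exceeds 1 and is simply
        dropped.\<close>
      have "1 * (\<bar>\<xi> \<bullet> b\<bar> * norm (fourier f \<xi>)) \<le> (2 * pi) * (\<bar>\<xi> \<bullet> b\<bar> * norm (fourier f \<xi>))"
        using pi_gt3 by (intro mult_right_mono) auto
      also have "\<dots> = norm (fourier (partial_deriv b f) \<xi>)"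
        using Suc.prems b by (simp add: fourier_partial_deriv norm_mult)
      finally have "norm \<xi> ^ N * (\<bar>\<xi> \<bullet> b\<bar> * norm (fourier f \<xi>)) \<le> norm \<xi> ^ N * norm (fourier (partial_deriv b f) \<xi>)"
        by (intro mult_left_mono) auto
      then show "norm \<xi> ^ N * (\<bar>\<xi> \<bullet> b\<bar> * norm (fourier f \<xi>)) \<le> B b"
        using B[OF b, of \<xi>] by linarith
    qed
    finally show ?thesis .
  qed
  then show ?case by blast
qed

lemma integrable_fourier_schwartz: "f \<in> schwartz \<Longrightarrow> integrable lborel (fourier f)"
  by (intro integrable_rapid_decay fourier_schwartz_decay fourier_measurable schwartz_measurable)

text \<open>This is what makes \<open>abs_D_powr s f\<close> a bounded Borel function. Since
  |\<xi>|^s \<le> 1 + |\<xi>|, decay of order N follows from orders N and N + 1 of the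
  transform.\<close>

lemma integrable_powr_fourier_schwartz:
  fixes f :: "'a::euclidean_space \<Rightarrow> complex"
  assumes f: "f \<in> schwartz" and s: "0 < s" "s < 1"
  shows "integrable lborel (\<lambda>\<xi>. of_real (norm \<xi> powr s) * fourier f \<xi>)"
proof (rule integrable_rapid_decay)
  note [measurable] = schwartz_measurable[OF f]
  show "(\<lambda>\<xi>. of_real (norm \<xi> powr s) * fourier f \<xi>) \<in> borel_measurable borel"
    by measurable
  fix N :: nat
  obtain B B' where B: "norm \<xi> ^ N * norm (fourier f \<xi>) \<le> B" "norm \<xi> ^ Suc N * norm (fourier f \<xi>) \<le> B'" for \<xi>
    using fourier_schwartz_decay[OF f] by metis
  have "norm \<xi> ^ N * norm (of_real (norm \<xi> powr s) * fourier f \<xi>) \<le> B + B'" for \<xi> :: 'a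
  proof -
    have "norm \<xi> powr s \<le> 1 + norm \<xi>"
    proof (cases "norm \<xi> \<le> 1")
      case True
      then have "norm \<xi> powr s \<le> 1" using s by (simp add: powr_le1)
      then show ?thesis using norm_ge_zero[of \<xi>] by linarith
    next
      case False
      then have "norm \<xi> powr s \<le> norm \<xi> powr 1" using s by (intro powr_mono) auto
      then show ?thesis using False by simp
    qed
    then have "norm \<xi> powr s * (norm \<xi> ^ N * norm (fourier f \<xi>)) \<le> (1 + norm \<xi>) * (norm \<xi> ^ N * norm (fourier f \<xi>))"
      by (intro mult_right_mono) auto
    also have "\<dots> \<le> B + B'"
      using B[of \<xi>] by (simp add: algebra_simps)
    finally show ?thesis
      by (simp add: norm_mult mult_ac)
  qed
  then show "\<exists>B. \<forall>\<xi>. norm \<xi> ^ N * norm (of_real (norm \<xi> powr s) * fourier f \<xi>) \<le> B"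
    by blast
qed

section \<open>Fourier inversion by Gaussian summability\<close>

lemma integrable_product:
  fixes u :: "'a \<Rightarrow> complex" and v :: "'b \<Rightarrow> complex"
  assumes "pair_sigma_finite M N" and u: "integrable M u" and v: "integrable N v"
  shows "integrable (M \<Otimes>\<^sub>M N) (\<lambda>(x, y). u x * v y)"
proof -
  interpret pair_sigma_finite M N by fact
  have [measurable]: "u \<in> borel_measurable M" "v \<in> borel_measurable N"
    using u v by auto
  show ?thesis
    using u v by (intro Fubini_integrable) (auto simp: norm_mult)
qed

lemma fourier_gauss_affine:
  fixes w :: "'a::euclidean_space"
  assumes "0 < \<delta>"
  shows "(\<integral>\<xi>. of_real (gauss (\<delta> *\<^sub>R \<xi>)) * cis (2 * pi * (w \<bullet> \<xi>)) \<partial>lborel)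
    = complex_of_real ((1 / \<delta>) ^ DIM('a) * exp (- (norm ((2 * pi / \<delta>) *\<^sub>R w))\<^sup>2 / 2))"
proof -
  have "(\<integral>\<xi>. of_real (gauss (\<delta> *\<^sub>R \<xi>)) * cis (2 * pi * (w \<bullet> \<xi>)) \<partial>lborel)
    = \<bar>1 / \<delta>\<bar> ^ DIM('a) *\<^sub>R (\<integral>\<eta>. of_real (gauss (\<delta> *\<^sub>R (0 + (1 / \<delta>) *\<^sub>R \<eta>))) * cis (2 * pi * (w \<bullet> (0 + (1 / \<delta>) *\<^sub>R \<eta>))) \<partial>lborel)"
    using assms by (intro integral_affine) auto
  also have "(\<integral>\<eta>. of_real (gauss (\<delta> *\<^sub>R (0 + (1 / \<delta>) *\<^sub>R \<eta>))) * cis (2 * pi * (w \<bullet> (0 + (1 / \<delta>) *\<^sub>R \<eta>))) \<partial>lborel)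
    = (\<integral>\<eta>. of_real (gauss \<eta>) * cis (\<eta> \<bullet> ((2 * pi / \<delta>) *\<^sub>R w)) \<partial>lborel)"
    using assms by (simp add: inner_commute)
  also note fourier_gauss
  finally show ?thesis using assms by (simp add: scaleR_conv_of_real)
qed

text \<open>A Gaussian cutoff in frequency makes Fubini applicable and turns the inverse transform
  into an average of f over a Gaussian of width \<delta> around x. As \<delta> tends to 0, dominated
  convergence handles both sides, by integrability of the transform on one and by boundedness and
  continuity of f on the other.\<close>

lemma fourier_inversion:
  fixes f :: "'a::euclidean_space \<Rightarrow> complex"
  assumes f: "integrable lborel f" and cont: "continuous_on UNIV f" and bnd: "\<And>x. norm (f x) \<le> B"
    and fh: "integrable lborel (fourier f)"
  shows "inverse_fourier (fourier f) x = f x"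
proof -
  have [measurable]: "f \<in> borel_measurable borel" "fourier f \<in> borel_measurable borel"
    using f fh by (auto dest: borel_measurable_integrable)
  define \<delta> where "\<delta> k = 1 / real (Suc k)" for k
  have \<delta>: "0 < \<delta> k" for k by (simp add: \<delta>_def)
  have \<delta>0: "\<delta> \<longlonglongrightarrow> 0"
    unfolding \<delta>_def[abs_def] using LIMSEQ_inverse_real_of_nat by (simp add: inverse_eq_divide)
  have g0: "gauss v = gauss (0::'a) * exp (- (norm v)\<^sup>2 / 2)" for v :: 'a
    by (simp add: gauss_eq)
  \<comment> \<open>Multiplying by \<open>gauss 0\<close> turns the kernel exp (- |v|^2 / 2) on the
    right into \<open>gauss v\<close>, of mass 1. The limit on the left then carries the square of
    \<open>gauss 0\<close>, which equals the constant on the right and cancels.\<close>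
  have key: "(\<integral>\<xi>. fourier f \<xi> * cis (2 * pi * (x \<bullet> \<xi>)) * of_real (gauss ((2 * pi * \<delta> k) *\<^sub>R \<xi>)) \<partial>lborel) * of_real (gauss (0 :: 'a))
      = (1 / (2 * pi)) ^ DIM('a) * (\<integral>v. f (x + \<delta> k *\<^sub>R v) * of_real (gauss v) \<partial>lborel)" for k
  proof -
    \<comment> \<open>Chosen so that \<open>2 * pi / ?d\<close> is \<open>1 / \<delta> k\<close>,
      the inverse width of the resulting Gaussian in space.\<close>
    let ?d = "2 * pi * \<delta> k"
    note \<delta>k = \<delta>[of k]
    have d: "0 < ?d" using \<delta>k by simp
    have gd: "integrable lborel (\<lambda>\<xi>::'a. complex_of_real (gauss (?d *\<^sub>R \<xi>)))"
    proof -
      have nz: "\<bar>?d\<bar> ^ DIM('a) \<noteq> 0" using \<delta>k by simp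
      have L: "lborel = density (distr lborel borel (\<lambda>x::'a. 0 + ?d *\<^sub>R x)) (\<lambda>_. \<bar>?d\<bar> ^ DIM('a))"
        using \<delta>k by (intro lborel_affine) simp
      have "integrable (density (distr lborel borel (\<lambda>x::'a. 0 + ?d *\<^sub>R x)) (\<lambda>_. \<bar>?d\<bar> ^ DIM('a))) gauss"
        using integrable_gauss L by metis
      then show ?thesis
        using nz by (subst (asm) integrable_density) (auto simp: integrable_distr_eq simp del: power_eq_0_iff)
    qed
    have int: "integrable (lborel \<Otimes>\<^sub>M lborel)
        (\<lambda>(u, \<xi>). (f u * of_real (gauss (?d *\<^sub>R \<xi>))) * cis (2 * pi * ((x - u) \<bullet> \<xi>)))"
      using integrable_mult_cis[OF integrable_product[OF lborel_pair.pair_sigma_finite_axioms f gd],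
          of "\<lambda>(u, \<xi>). 2 * pi * ((x - u) \<bullet> \<xi>)"] by (simp add: case_prod_unfold)
    have "(\<integral>\<xi>. fourier f \<xi> * cis (2 * pi * (x \<bullet> \<xi>)) * of_real (gauss (?d *\<^sub>R \<xi>)) \<partial>lborel)
        = (\<integral>\<xi>. (\<integral>u. (f u * of_real (gauss (?d *\<^sub>R \<xi>))) * cis (2 * pi * ((x - u) \<bullet> \<xi>)) \<partial>lborel) \<partial>lborel)"
    proof (rule Bochner_Integration.integral_cong[OF refl])
      fix \<xi>
      have "cis (2 * pi * ((x - u) \<bullet> \<xi>)) = cis (- 2 * pi * (u \<bullet> \<xi>)) * cis (2 * pi * (x \<bullet> \<xi>))" for u
        by (simp add: cis_mult inner_diff_left algebra_simps)
      then have eq: "(f u * of_real (gauss (?d *\<^sub>R \<xi>))) * cis (2 * pi * ((x - u) \<bullet> \<xi>))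
          = (f u * cis (- 2 * pi * (u \<bullet> \<xi>))) * (cis (2 * pi * (x \<bullet> \<xi>)) * of_real (gauss (?d *\<^sub>R \<xi>)))" for u
        by simp
      show "fourier f \<xi> * cis (2 * pi * (x \<bullet> \<xi>)) * of_real (gauss (?d *\<^sub>R \<xi>))
          = (\<integral>u. (f u * of_real (gauss (?d *\<^sub>R \<xi>))) * cis (2 * pi * ((x - u) \<bullet> \<xi>)) \<partial>lborel)"
        unfolding eq integral_mult_left_zero fourier_lborel[OF \<open>f \<in> borel_measurable borel\<close>] by (rule mult.assoc)
    qed
    also have "\<dots> = (\<integral>u. (\<integral>\<xi>. (f u * of_real (gauss (?d *\<^sub>R \<xi>))) * cis (2 * pi * ((x - u) \<bullet> \<xi>)) \<partial>lborel) \<partial>lborel)"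
      using lborel_pair.Fubini_integral[OF int] by simp
    also have "\<dots> = (\<integral>u. f u * complex_of_real ((1 / ?d) ^ DIM('a) * exp (- (norm ((2 * pi / ?d) *\<^sub>R (x - u)))\<^sup>2 / 2)) \<partial>lborel)"
      by (simp only: mult.assoc[of "f _"] integral_mult_right_zero fourier_gauss_affine[OF d])
    also have "\<dots> = \<bar>\<delta> k\<bar> ^ DIM('a) *\<^sub>R (\<integral>v. f (x + \<delta> k *\<^sub>R v) *
        complex_of_real ((1 / ?d) ^ DIM('a) * exp (- (norm ((2 * pi / ?d) *\<^sub>R (x - (x + \<delta> k *\<^sub>R v))))\<^sup>2 / 2)) \<partial>lborel)"
      using \<delta>[of k] by (intro integral_affine) auto
    also have "\<dots> * of_real (gauss (0 :: 'a)) = complex_of_real (\<delta> k ^ DIM('a) * (1 / ?d) ^ DIM('a)) *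
        (\<integral>v. f (x + \<delta> k *\<^sub>R v) * complex_of_real (gauss v) \<partial>lborel)"
    proof -
      have n: "norm ((2 * pi / ?d) *\<^sub>R (x - (x + \<delta> k *\<^sub>R v))) = norm v" for v
        using \<delta>[of k] by (simp add: field_simps)
      have "(\<integral>v. f (x + \<delta> k *\<^sub>R v) * complex_of_real ((1 / ?d) ^ DIM('a) * exp (- (norm v)\<^sup>2 / 2)) \<partial>lborel) * of_real (gauss (0 :: 'a))
          = (\<integral>v. complex_of_real ((1 / ?d) ^ DIM('a)) * (f (x + \<delta> k *\<^sub>R v) * complex_of_real (gauss v)) \<partial>lborel)"
        unfolding integral_mult_left_zero[symmetric]
        by (intro Bochner_Integration.integral_cong refl) (subst (2) g0, simp add: mult_ac)
      then show ?thesis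
        using \<delta>[of k] unfolding n integral_mult_right_zero by (simp add: scaleR_conv_of_real mult_ac)
    qed
    also have "\<delta> k ^ DIM('a) * (1 / ?d) ^ DIM('a) = (1 / (2 * pi)) ^ DIM('a)"
      using \<delta>[of k] by (simp add: power_mult_distrib[symmetric])
    finally show ?thesis by simp
  qed
  have cg: "isCont (gauss :: 'a \<Rightarrow> real) v" for v
    unfolding gauss_eq[abs_def] by (intro continuous_intros) auto
  have gle: "gauss v \<le> gauss (0::'a)" for v :: 'a
    by (subst g0) (simp add: gauss_pos mult_le_cancel_left1 less_imp_le)
  have "(\<lambda>k. \<integral>\<xi>. fourier f \<xi> * cis (2 * pi * (x \<bullet> \<xi>)) * of_real (gauss ((2 * pi * \<delta> k) *\<^sub>R \<xi>)) \<partial>lborel)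
      \<longlonglongrightarrow> (\<integral>\<xi>. fourier f \<xi> * cis (2 * pi * (x \<bullet> \<xi>)) * of_real (gauss (0::'a)) \<partial>lborel)"
  proof (rule integral_dominated_convergence[where w="\<lambda>\<xi>. norm (fourier f \<xi>) * gauss (0::'a)"])
    show "AE \<xi> in lborel. (\<lambda>k. fourier f \<xi> * cis (2 * pi * (x \<bullet> \<xi>)) * of_real (gauss ((2 * pi * \<delta> k) *\<^sub>R \<xi>)))
        \<longlonglongrightarrow> fourier f \<xi> * cis (2 * pi * (x \<bullet> \<xi>)) * of_real (gauss (0::'a))"
    proof (intro AE_I2 tendsto_intros)
      fix \<xi> :: 'a
      have "(\<lambda>k. (2 * pi * \<delta> k) *\<^sub>R \<xi>) \<longlonglongrightarrow> (2 * pi * 0) *\<^sub>R \<xi>"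
        by (intro tendsto_intros \<delta>0)
      then show "(\<lambda>k. gauss ((2 * pi * \<delta> k) *\<^sub>R \<xi>)) \<longlonglongrightarrow> gauss (0::'a)"
        using isCont_tendsto_compose[OF cg] by fastforce
    qed
    show "AE \<xi> in lborel. norm (fourier f \<xi> * cis (2 * pi * (x \<bullet> \<xi>)) * of_real (gauss ((2 * pi * \<delta> k) *\<^sub>R \<xi>)))
        \<le> norm (fourier f \<xi>) * gauss (0::'a)" for k
      using gle by (intro AE_I2) (simp add: norm_mult mult_left_mono gauss_pos less_imp_le)
  qed (use fh in auto)
  then have "(\<lambda>k. (\<integral>\<xi>. fourier f \<xi> * cis (2 * pi * (x \<bullet> \<xi>)) * of_real (gauss ((2 * pi * \<delta> k) *\<^sub>R \<xi>)) \<partial>lborel) * of_real (gauss (0 :: 'a)))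
      \<longlonglongrightarrow> (\<integral>\<xi>. fourier f \<xi> * cis (2 * pi * (x \<bullet> \<xi>)) * of_real (gauss (0::'a)) \<partial>lborel) * of_real (gauss (0 :: 'a))"
    by (intro tendsto_intros)
  then have lim1: "(\<lambda>k. (1 / (2 * pi)) ^ DIM('a) * (\<integral>v. f (x + \<delta> k *\<^sub>R v) * of_real (gauss v) \<partial>lborel))
      \<longlonglongrightarrow> inverse_fourier (fourier f) x * of_real ((gauss (0::'a))\<^sup>2)"
    unfolding key by (simp add: inverse_fourier_lborel power2_eq_square mult.assoc[symmetric])
  have "(\<lambda>k. \<integral>v. f (x + \<delta> k *\<^sub>R v) * of_real (gauss v) \<partial>lborel) \<longlonglongrightarrow> (\<integral>v. f x * of_real (gauss v) \<partial>(lborel :: 'a measure))"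
  proof (rule integral_dominated_convergence[where w="\<lambda>v. B * gauss v"])
    show "AE v in lborel. (\<lambda>k. f (x + \<delta> k *\<^sub>R v) * of_real (gauss v)) \<longlonglongrightarrow> f x * of_real (gauss v)"
    proof (intro AE_I2 tendsto_intros)
      fix v :: 'a
      have "(\<lambda>k. x + \<delta> k *\<^sub>R v) \<longlonglongrightarrow> x + 0 *\<^sub>R v"
        by (intro tendsto_intros \<delta>0)
      moreover have "isCont f x"
        using cont by (simp add: continuous_on_eq_continuous_at)
      ultimately show "(\<lambda>k. f (x + \<delta> k *\<^sub>R v)) \<longlonglongrightarrow> f x"
        using isCont_tendsto_compose[of x f] by simp
    qed
    show "AE v in lborel. norm (f (x + \<delta> k *\<^sub>R v) * of_real (gauss v)) \<le> B * gauss v" for k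
      using bnd by (intro AE_I2) (simp add: norm_mult mult_right_mono gauss_pos less_imp_le)
    show "integrable lborel (\<lambda>v::'a. B * gauss v)"
      using integrable_gauss by (rule integrable_mult_right)
  qed auto
  then have lim2: "(\<lambda>k. (1 / (2 * pi)) ^ DIM('a) * (\<integral>v. f (x + \<delta> k *\<^sub>R v) * of_real (gauss v) \<partial>lborel))
      \<longlonglongrightarrow> (1 / (2 * pi)) ^ DIM('a) * (\<integral>v. f x * of_real (gauss v) \<partial>(lborel :: 'a measure))"
    by (intro tendsto_intros)
  have "inverse_fourier (fourier f) x * of_real ((gauss (0::'a))\<^sup>2)
      = (1 / (2 * pi)) ^ DIM('a) * (\<integral>v. f x * of_real (gauss v) \<partial>(lborel :: 'a measure))"
    by (rule LIMSEQ_unique[OF lim1 lim2])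
  moreover have "(\<integral>v. f x * of_real (gauss v) \<partial>(lborel :: 'a measure)) = f x"
    using integral_gauss[where 'a='a] by (simp add: integral_complex_of_real)
  moreover have "(gauss (0::'a))\<^sup>2 = (1 / (2 * pi)) ^ DIM('a)"
  proof -
    have "(y ^ n)\<^sup>2 = (y\<^sup>2) ^ n" for y :: real and n
      by (metis power_even_eq power_mult)
    then show ?thesis by (simp add: gauss_eq power_divide)
  qed
  ultimately show ?thesis
    by simp
qed

lemma schwartz_inversion: "f \<in> schwartz \<Longrightarrow> inverse_fourier (fourier f) x = f x"
  by (metis fourier_inversion integrable_fourier_schwartz schwartz_bounded schwartz_continuous schwartz_integrable)

section \<open>The modulus of continuity in Lebesgue norms\<close>

text \<open>Convolution with a Gaussian of width \<tau> is damping in frequency. The exponent 2 pi^2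
  \<tau>^2 |\<xi>|^2 is |v|^2 / 2 for the vector v = -2 pi \<tau> \<xi> put into
  \<open>fourier_gauss\<close>.\<close>

lemma gauss_average_inverse_fourier:
  fixes \<phi> :: "'a::euclidean_space \<Rightarrow> complex"
  assumes \<phi>: "integrable lborel \<phi>"
  shows "(\<integral>z. of_real (gauss z) * inverse_fourier \<phi> (x - \<tau> *\<^sub>R z) \<partial>lborel)
    = (\<integral>\<xi>. \<phi> \<xi> * cis (2 * pi * (x \<bullet> \<xi>)) * of_real (exp (- 2 * pi\<^sup>2 * \<tau>\<^sup>2 * (norm \<xi>)\<^sup>2)) \<partial>lborel)"
proof -
  have [measurable]: "\<phi> \<in> borel_measurable borel"
    using \<phi> by (auto dest: borel_measurable_integrable)
  have int: "integrable (lborel \<Otimes>\<^sub>M lborel)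
      (\<lambda>(z, \<xi>). (of_real (gauss z) * \<phi> \<xi>) * cis (2 * pi * ((x - \<tau> *\<^sub>R z) \<bullet> \<xi>)))"
    using integrable_mult_cis[OF integrable_product[OF lborel_pair.pair_sigma_finite_axioms
          integrable_of_real[OF integrable_gauss] \<phi>],
        of "\<lambda>(z, \<xi>). 2 * pi * ((x - \<tau> *\<^sub>R z) \<bullet> \<xi>)"] by (simp add: case_prod_unfold)
  have "(\<integral>z. of_real (gauss z) * inverse_fourier \<phi> (x - \<tau> *\<^sub>R z) \<partial>lborel)
      = (\<integral>z. (\<integral>\<xi>. (of_real (gauss z) * \<phi> \<xi>) * cis (2 * pi * ((x - \<tau> *\<^sub>R z) \<bullet> \<xi>)) \<partial>lborel) \<partial>lborel)"
    by (simp only: mult.assoc integral_mult_right_zero inverse_fourier_lborel[OF \<open>\<phi> \<in> borel_measurable borel\<close>])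
  also have "\<dots> = (\<integral>\<xi>. (\<integral>z. (of_real (gauss z) * \<phi> \<xi>) * cis (2 * pi * ((x - \<tau> *\<^sub>R z) \<bullet> \<xi>)) \<partial>lborel) \<partial>lborel)"
    using lborel_pair.Fubini_integral[OF int] by simp
  also have "\<dots> = (\<integral>\<xi>. \<phi> \<xi> * cis (2 * pi * (x \<bullet> \<xi>)) * of_real (exp (- 2 * pi\<^sup>2 * \<tau>\<^sup>2 * (norm \<xi>)\<^sup>2)) \<partial>lborel)"
  proof (rule Bochner_Integration.integral_cong[OF refl])
    fix \<xi>
    have "cis (2 * pi * ((x - \<tau> *\<^sub>R z) \<bullet> \<xi>)) = cis (2 * pi * (x \<bullet> \<xi>)) * cis (z \<bullet> ((- 2 * pi * \<tau>) *\<^sub>R \<xi>))" for z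
      by (simp add: cis_mult inner_diff_left algebra_simps)
    then have "(of_real (gauss z) * \<phi> \<xi>) * cis (2 * pi * ((x - \<tau> *\<^sub>R z) \<bullet> \<xi>))
        = \<phi> \<xi> * cis (2 * pi * (x \<bullet> \<xi>)) * (of_real (gauss z) * cis (z \<bullet> ((- 2 * pi * \<tau>) *\<^sub>R \<xi>)))" for z
      by (simp only: mult_ac)
    then have "(\<integral>z. (of_real (gauss z) * \<phi> \<xi>) * cis (2 * pi * ((x - \<tau> *\<^sub>R z) \<bullet> \<xi>)) \<partial>lborel)
        = \<phi> \<xi> * cis (2 * pi * (x \<bullet> \<xi>)) * of_real (exp (- (norm ((- 2 * pi * \<tau>) *\<^sub>R \<xi>))\<^sup>2 / 2))"
      by (simp only: integral_mult_right_zero fourier_gauss)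
    also have "- (norm ((- 2 * pi * \<tau>) *\<^sub>R \<xi>))\<^sup>2 / 2 = - 2 * pi\<^sup>2 * \<tau>\<^sup>2 * (norm \<xi>)\<^sup>2"
      by (simp add: power_mult_distrib abs_mult)
    finally show "(\<integral>z. (of_real (gauss z) * \<phi> \<xi>) * cis (2 * pi * ((x - \<tau> *\<^sub>R z) \<bullet> \<xi>)) \<partial>lborel)
        = \<phi> \<xi> * cis (2 * pi * (x \<bullet> \<xi>)) * of_real (exp (- 2 * pi\<^sup>2 * \<tau>\<^sup>2 * (norm \<xi>)\<^sup>2))" .
  qed
  finally show ?thesis .
qed

text \<open>Shifting z by y / \<tau> moves the translated Gaussian to the base point x - y, so the
  difference of kernels acts as the difference of two plain averages, at x and at x - y.\<close>

lemma gauss_difference_inverse_fourier: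
  fixes \<phi> :: "'a::euclidean_space \<Rightarrow> complex"
  assumes \<phi>: "integrable lborel \<phi>" and \<tau>: "0 < \<tau>"
  shows "(\<integral>z. of_real (gauss z - gauss (z - (1 / \<tau>) *\<^sub>R y)) * inverse_fourier \<phi> (x - \<tau> *\<^sub>R z) \<partial>lborel)
    = (\<integral>\<xi>. \<phi> \<xi> * (cis (2 * pi * (x \<bullet> \<xi>)) - cis (2 * pi * ((x - y) \<bullet> \<xi>)))
        * of_real (exp (- 2 * pi\<^sup>2 * \<tau>\<^sup>2 * (norm \<xi>)\<^sup>2)) \<partial>lborel)"
proof -
  have [measurable]: "\<phi> \<in> borel_measurable borel"
    using \<phi> by (auto dest: borel_measurable_integrable)
  let ?\<Phi> = "inverse_fourier \<phi>"
  let ?B = "\<integral>\<xi>. norm (\<phi> \<xi>) \<partial>lborel"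
  have int: "integrable lborel (\<lambda>z. of_real (gauss z) * ?\<Phi> (w - \<tau> *\<^sub>R z))" for w
  proof (rule Bochner_Integration.integrable_bound)
    show "integrable lborel (\<lambda>z::'a. ?B * gauss z)"
      by (intro integrable_mult_right integrable_gauss)
    show "AE z in lborel. norm (of_real (gauss z) * ?\<Phi> (w - \<tau> *\<^sub>R z)) \<le> norm (?B * gauss z)"
    proof (rule AE_I2)
      fix z :: 'a
      have "gauss z * norm (?\<Phi> (w - \<tau> *\<^sub>R z)) \<le> gauss z * ?B"
        by (intro mult_left_mono norm_inverse_fourier_le \<phi>) (simp add: gauss_pos less_imp_le)
      then show "norm (of_real (gauss z) * ?\<Phi> (w - \<tau> *\<^sub>R z)) \<le> norm (?B * gauss z)"
        by (simp add: norm_mult gauss_pos less_imp_le abs_mult mult.commute)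
    qed
  qed measurable
  let ?t = "- ((1 / \<tau>) *\<^sub>R y)"
  have shift: "of_real (gauss (z + ?t)) * ?\<Phi> ((x - y) - \<tau> *\<^sub>R (z + ?t))
      = of_real (gauss (z - (1 / \<tau>) *\<^sub>R y)) * ?\<Phi> (x - \<tau> *\<^sub>R z)" for z
    using \<tau> by (simp add: scaleR_diff_right)
  have int': "integrable lborel (\<lambda>z. of_real (gauss (z - (1 / \<tau>) *\<^sub>R y)) * ?\<Phi> (x - \<tau> *\<^sub>R z))"
    using integrable_translate[OF int[of "x - y"], of ?t] unfolding shift .
  have "(\<integral>z. of_real (gauss (z - (1 / \<tau>) *\<^sub>R y)) * ?\<Phi> (x - \<tau> *\<^sub>R z) \<partial>lborel)
      = (\<integral>z. of_real (gauss z) * ?\<Phi> ((x - y) - \<tau> *\<^sub>R z) \<partial>lborel)"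
    using integral_translate[of "\<lambda>z. of_real (gauss z) * ?\<Phi> ((x - y) - \<tau> *\<^sub>R z)" ?t] unfolding shift by simp
  then have "(\<integral>z. of_real (gauss z - gauss (z - (1 / \<tau>) *\<^sub>R y)) * ?\<Phi> (x - \<tau> *\<^sub>R z) \<partial>lborel)
      = (\<integral>z. of_real (gauss z) * ?\<Phi> (x - \<tau> *\<^sub>R z) \<partial>lborel) - (\<integral>z. of_real (gauss z) * ?\<Phi> ((x - y) - \<tau> *\<^sub>R z) \<partial>lborel)"
    using int int' by (simp add: left_diff_distrib)
  also have "\<dots> = (\<integral>\<xi>. \<phi> \<xi> * cis (2 * pi * (x \<bullet> \<xi>)) * of_real (exp (- 2 * pi\<^sup>2 * \<tau>\<^sup>2 * (norm \<xi>)\<^sup>2))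
      - \<phi> \<xi> * cis (2 * pi * ((x - y) \<bullet> \<xi>)) * of_real (exp (- 2 * pi\<^sup>2 * \<tau>\<^sup>2 * (norm \<xi>)\<^sup>2)) \<partial>lborel)"
  proof -
    have "integrable lborel (\<lambda>\<xi>. \<phi> \<xi> * cis (2 * pi * (w \<bullet> \<xi>)) * of_real (exp (- 2 * pi\<^sup>2 * \<tau>\<^sup>2 * (norm \<xi>)\<^sup>2)))" for w
      by (rule Bochner_Integration.integrable_bound[OF \<phi>])
        (auto simp: norm_mult mult_left_le)
    then show ?thesis
      unfolding gauss_average_inverse_fourier[OF \<phi>] by (intro Bochner_Integration.integral_diff[symmetric])
  qed
  finally show ?thesis by (simp add: algebra_simps)
qed

text \<open>The value at |\<xi>| = 1 of the integral representing |\<xi>|^(-s); for s > 0 it equals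
  Gamma(s/2) / (2 (2 pi^2)^(s/2)). It is an \<open>ennreal\<close> so that it makes sense before
  finiteness is known.\<close>

definition subordination_const :: "real \<Rightarrow> ennreal" where
  "subordination_const s = (\<integral>\<^sup>+ \<tau>. ennreal (\<tau> powr (s - 1) * exp (- 2 * pi\<^sup>2 * \<tau>\<^sup>2)) * indicator {0<..} \<tau> \<partial>lborel)"

text \<open>The chain \<tau> \<le> 1 + \<tau>^2 \<le> exp (2 pi^2 \<tau>^2) bounds the Gaussian by
  min 1 (1 / \<tau>), which reduces the claim to \<open>nn_integral_powr_min\<close> with a =
  1.\<close>

lemma subordination_const_finite:
  assumes "0 < s" "s < 1"
  shows "subordination_const s < \<infinity>"
proof -
  have "subordination_const s \<le> (\<integral>\<^sup>+ \<tau>. ennreal (\<tau> powr (s - 1) * min 1 (1 / \<tau>)) * indicator {0<..} \<tau> \<partial>lborel)"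
    unfolding subordination_const_def
  proof (intro nn_integral_mono)
    fix \<tau> :: real
    have "exp (- 2 * pi\<^sup>2 * \<tau>\<^sup>2) \<le> min 1 (1 / \<tau>)" if "0 < \<tau>"
    proof -
      have "0 \<le> (\<tau> - 1/2)\<^sup>2" by simp
      then have "\<tau> \<le> 1 + \<tau>\<^sup>2" by (simp add: power2_eq_square algebra_simps)
      also have "1 * \<tau>\<^sup>2 \<le> 2 * pi\<^sup>2 * \<tau>\<^sup>2"
      proof (intro mult_right_mono)
        have "1 \<le> pi\<^sup>2" using pi_gt3 by (intro one_le_power) simp
        then show "1 \<le> 2 * pi\<^sup>2" by simp
      qed simp
      then have "1 + \<tau>\<^sup>2 \<le> 1 + 2 * pi\<^sup>2 * \<tau>\<^sup>2" by simp
      also have "\<dots> \<le> exp (2 * pi\<^sup>2 * \<tau>\<^sup>2)" by (rule exp_ge_add_one_self)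
      finally have "exp (- (2 * pi\<^sup>2 * \<tau>\<^sup>2)) \<le> 1 / \<tau>"
        using that by (simp add: exp_minus field_simps)
      then show ?thesis by simp
    qed
    then show "ennreal (\<tau> powr (s - 1) * exp (- 2 * pi\<^sup>2 * \<tau>\<^sup>2)) * indicator {0<..} \<tau>
        \<le> ennreal (\<tau> powr (s - 1) * min 1 (1 / \<tau>)) * indicator {0<..} \<tau>"
      by (auto simp: indicator_def intro!: ennreal_leI mult_left_mono)
  qed
  also have "\<dots> \<le> ennreal (1 powr s * (1 / s + 1 / (1 - s)))"
    by (intro nn_integral_powr_min assms) simp
  also have "\<dots> < \<infinity>" by simp
  finally show ?thesis .
qed

lemma subordination_const_pos: "0 < subordination_const s"
proof (rule ccontr)
  assume "\<not> ?thesis"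
  then have "subordination_const s = 0" by (simp add: zero_less_iff_neq_zero)
  then have "AE \<tau> in lborel. ennreal (\<tau> powr (s - 1) * exp (- 2 * pi\<^sup>2 * \<tau>\<^sup>2)) * indicator {0<..} \<tau> = 0"
    unfolding subordination_const_def by (subst (asm) nn_integral_0_iff_AE) auto
  then have "AE \<tau> in lborel. \<tau> \<notin> {0<..<1::real}"
    by eventually_elim (auto simp: indicator_def ennreal_eq_0_iff mult_le_0_iff not_le)
  then have "emeasure lborel {0<..<1::real} = 0"
    by (subst (asm) AE_iff_measurable[OF _ refl]) (auto simp: Collect_conj_eq greaterThanLessThan_def greaterThan_def lessThan_def)
  then show False by simp
qed

text \<open>Homogeneity under \<tau> to \<tau> / a: the Jacobian contributes a^(-1) and the power of
  \<tau> contributes a^(1 - s).\<close>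

lemma subordination:
  assumes "0 < a"
  shows "(\<integral>\<^sup>+ \<tau>. ennreal (\<tau> powr (s - 1) * exp (- 2 * pi\<^sup>2 * \<tau>\<^sup>2 * a\<^sup>2)) * indicator {0<..} \<tau> \<partial>lborel)
    = ennreal (a powr (- s)) * subordination_const s"
proof -
  have "(\<integral>\<^sup>+ \<tau>. ennreal (\<tau> powr (s - 1) * exp (- 2 * pi\<^sup>2 * \<tau>\<^sup>2 * a\<^sup>2)) * indicator {0<..} \<tau> \<partial>lborel)
     = ennreal \<bar>1 / a\<bar> * (\<integral>\<^sup>+ \<tau>. ennreal ((0 + 1 / a * \<tau>) powr (s - 1) * exp (- 2 * pi\<^sup>2 * (0 + 1 / a * \<tau>)\<^sup>2 * a\<^sup>2))
          * indicator {0<..} (0 + 1 / a * \<tau>) \<partial>lborel)"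
    using assms by (intro nn_integral_real_affine) auto
  also have "(\<integral>\<^sup>+ \<tau>. ennreal ((0 + 1 / a * \<tau>) powr (s - 1) * exp (- 2 * pi\<^sup>2 * (0 + 1 / a * \<tau>)\<^sup>2 * a\<^sup>2))
          * indicator {0<..} (0 + 1 / a * \<tau>) \<partial>lborel)
      = (\<integral>\<^sup>+ \<tau>. ennreal (a powr (1 - s)) * (ennreal (\<tau> powr (s - 1) * exp (- 2 * pi\<^sup>2 * \<tau>\<^sup>2)) * indicator {0<..} \<tau>) \<partial>lborel)"
  proof (rule nn_integral_cong)
    fix \<tau> :: real
    show "ennreal ((0 + 1 / a * \<tau>) powr (s - 1) * exp (- 2 * pi\<^sup>2 * (0 + 1 / a * \<tau>)\<^sup>2 * a\<^sup>2)) * indicator {0<..} (0 + 1 / a * \<tau>)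
      = ennreal (a powr (1 - s)) * (ennreal (\<tau> powr (s - 1) * exp (- 2 * pi\<^sup>2 * \<tau>\<^sup>2)) * indicator {0<..} \<tau>)"
    proof (cases "0 < \<tau>")
      case True
      have "(0 + 1 / a * \<tau>) powr (s - 1) = a powr (1 - s) * \<tau> powr (s - 1)"
        using True assms by (simp add: powr_divide powr_diff)
      moreover have "- 2 * pi\<^sup>2 * (0 + 1 / a * \<tau>)\<^sup>2 * a\<^sup>2 = - 2 * pi\<^sup>2 * \<tau>\<^sup>2"
        using assms by (simp add: power_divide)
      ultimately show ?thesis
        using True assms by (simp add: ennreal_mult mult.assoc)
    qed (use assms in \<open>simp add: zero_less_divide_iff\<close>)
  qed
  also have "\<dots> = ennreal (a powr (1 - s)) * subordination_const s"
    unfolding subordination_const_def by (rule nn_integral_cmult) measurable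
  also have "ennreal \<bar>1 / a\<bar> * (ennreal (a powr (1 - s)) * subordination_const s)
      = ennreal (\<bar>1 / a\<bar> * a powr (1 - s)) * subordination_const s"
    by (subst mult.assoc[symmetric]) (simp add: ennreal_mult[symmetric])
  also have "\<bar>1 / a\<bar> * a powr (1 - s) = a powr (- s)"
    using assms by (simp add: powr_diff powr_minus divide_simps)
  finally show ?thesis .
qed

text \<open>In frequency the \<tau>-integral of the damping factors produces |\<xi>|^(-s), which
  cancels the symbol of |D|^s, and inversion for f finishes. Fubini is justified because the
  \<tau>-integral of the absolute value is \<open>?c\<close> times the modulus of
  \<open>fourier f \<xi>\<close> times a factor at most 2.\<close>

lemma schwartz_difference_representation:
  fixes f :: "'a::euclidean_space \<Rightarrow> complex"
  assumes f: "f \<in> schwartz" and s: "0 < s" "s < 1"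
  shows "of_real (enn2real (subordination_const s)) * (f x - f (x - y))
    = (\<integral>\<tau>. of_real (\<tau> powr (s - 1) * indicator {0<..} \<tau>) *
         (\<integral>z. of_real (gauss z - gauss (z - (1 / \<tau>) *\<^sub>R y)) * abs_D_powr s f (x - \<tau> *\<^sub>R z) \<partial>lborel) \<partial>lborel)"
proof -
  let ?c = "enn2real (subordination_const s)"
  have c: "subordination_const s = ennreal ?c"
    using subordination_const_finite[OF s] by simp
  note [measurable] = schwartz_measurable[OF f]
  define \<phi> where "\<phi> \<xi> = of_real (norm \<xi> powr s) * fourier f \<xi>" for \<xi>
  have \<phi>: "integrable lborel \<phi>"
    unfolding \<phi>_def[abs_def] by (rule integrable_powr_fourier_schwartz[OF f s])
  then have [measurable]: "\<phi> \<in> borel_measurable borel"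
    by (auto dest: borel_measurable_integrable)
  have F: "abs_D_powr s f = inverse_fourier \<phi>"
    by (simp add: abs_D_powr_def fourier_multiplier_def \<phi>_def[abs_def])
  let ?E = "\<lambda>\<xi>. cis (2 * pi * (x \<bullet> \<xi>)) - cis (2 * pi * ((x - y) \<bullet> \<xi>))"
  let ?K = "\<lambda>\<tau> \<xi>. \<tau> powr (s - 1) * exp (- 2 * pi\<^sup>2 * \<tau>\<^sup>2 * (norm \<xi>)\<^sup>2) * indicator {0<..} \<tau>"
  let ?H = "\<lambda>\<tau> \<xi>. of_real (?K \<tau> \<xi>) * (\<phi> \<xi> * ?E \<xi>)"
  have K0: "0 \<le> ?K \<tau> \<xi>" for \<tau> \<xi> by simp
  have Kn: "(\<integral>\<^sup>+ \<tau>. ennreal (?K \<tau> \<xi>) \<partial>lborel) = ennreal (norm \<xi> powr (- s) * ?c)" if "\<xi> \<noteq> 0" for \<xi> :: 'a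
  proof -
    have "(\<integral>\<^sup>+ \<tau>. ennreal (?K \<tau> \<xi>) \<partial>lborel)
        = (\<integral>\<^sup>+ \<tau>. ennreal (\<tau> powr (s - 1) * exp (- 2 * pi\<^sup>2 * \<tau>\<^sup>2 * (norm \<xi>)\<^sup>2)) * indicator {0<..} \<tau> \<partial>lborel)"
      by (intro nn_integral_cong) (auto simp: indicator_def)
    also have "\<dots> = ennreal (norm \<xi> powr (- s)) * subordination_const s"
      using that by (intro subordination) simp
    finally have "(\<integral>\<^sup>+ \<tau>. ennreal (?K \<tau> \<xi>) \<partial>lborel) = ennreal (norm \<xi> powr (- s)) * subordination_const s" .
    then show ?thesis by (subst (asm) c) (simp add: ennreal_mult)
  qed
  have K1: "integrable lborel (\<lambda>\<tau>. ?K \<tau> \<xi>)" "(\<integral>\<tau>. ?K \<tau> \<xi> \<partial>lborel) = norm \<xi> powr (- s) * ?c" if "\<xi> \<noteq> 0" for \<xi> :: 'a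
  proof -
    have "(\<integral>\<^sup>+ \<tau>. ennreal (?K \<tau> \<xi>) \<partial>lborel) = ennreal (norm \<xi> powr (- s) * ?c) \<longleftrightarrow>
        integrable lborel (\<lambda>\<tau>. ?K \<tau> \<xi>) \<and> (\<integral>\<tau>. ?K \<tau> \<xi> \<partial>lborel) = norm \<xi> powr (- s) * ?c"
      by (intro nn_integral_eq_integrable AE_I2 K0) auto
    then show "integrable lborel (\<lambda>\<tau>. ?K \<tau> \<xi>)" "(\<integral>\<tau>. ?K \<tau> \<xi> \<partial>lborel) = norm \<xi> powr (- s) * ?c"
      using Kn[OF that] by blast+
  qed
  \<comment> \<open>At \<xi> = 0 there is no damping and \<open>?K\<close> is not integrable in
    \<tau>; \<open>0 powr s = 0\<close> makes the whole integrand vanish there.\<close>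
  have \<phi>0: "\<phi> 0 = 0" by (simp add: \<phi>_def)
  have red: "norm \<xi> powr (- s) * ?c * norm (\<phi> \<xi>) = ?c * norm (fourier f \<xi>)" if "\<xi> \<noteq> 0" for \<xi>
    using that by (simp add: \<phi>_def norm_mult powr_minus field_simps)
  have int: "integrable (lborel \<Otimes>\<^sub>M lborel) (\<lambda>(\<xi>, \<tau>). ?H \<tau> \<xi>)"
  proof (rule lborel_pair.Fubini_integrable)
    show "AE \<xi> in lborel. integrable lborel (\<lambda>\<tau>. case (\<xi>, \<tau>) of (\<xi>, \<tau>) \<Rightarrow> ?H \<tau> \<xi>)"
    proof (rule AE_I2)
      fix \<xi>
      show "integrable lborel (\<lambda>\<tau>. case (\<xi>, \<tau>) of (\<xi>, \<tau>) \<Rightarrow> ?H \<tau> \<xi>)"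
      proof (cases "\<xi> = 0")
        case False
        then show ?thesis
          unfolding prod.case by (intro integrable_mult_left integrable_of_real K1(1))
      qed (simp add: \<phi>0)
    qed
    have n: "(\<integral>\<tau>. norm (?H \<tau> \<xi>) \<partial>lborel) = ?c * norm (fourier f \<xi>) * norm (?E \<xi>)" if "\<xi> \<noteq> 0" for \<xi>
    proof -
      have "(\<integral>\<tau>. norm (?H \<tau> \<xi>) \<partial>lborel) = (\<integral>\<tau>. ?K \<tau> \<xi> * norm (\<phi> \<xi> * ?E \<xi>) \<partial>lborel)"
        by (simp add: norm_mult abs_mult)
      also have "\<dots> = (\<integral>\<tau>. ?K \<tau> \<xi> \<partial>lborel) * norm (\<phi> \<xi> * ?E \<xi>)"
        by (rule integral_mult_left_zero)
      also have "\<dots> = norm \<xi> powr (- s) * ?c * norm (\<phi> \<xi>) * norm (?E \<xi>)"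
        by (simp only: K1(2)[OF that] norm_mult)
      finally show ?thesis using red[OF that] by simp
    qed
    have "norm (?E \<xi>) \<le> 2" for \<xi>
      using norm_triangle_ineq4[of "cis (2 * pi * (x \<bullet> \<xi>))" "cis (2 * pi * ((x - y) \<bullet> \<xi>))"] by simp
    then have bound: "norm (\<integral>\<tau>. norm (?H \<tau> \<xi>) \<partial>lborel) \<le> norm (2 * ?c * norm (fourier f \<xi>))" for \<xi>
      using n[of \<xi>] \<phi>0 mult_left_mono[of "norm (?E \<xi>)" 2 "?c * norm (fourier f \<xi>)"]
      by (cases "\<xi> = 0") (auto simp: mult_ac)
    show "integrable lborel (\<lambda>\<xi>. \<integral>\<tau>. norm (case (\<xi>, \<tau>) of (\<xi>, \<tau>) \<Rightarrow> ?H \<tau> \<xi>) \<partial>lborel)"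
    proof (rule Bochner_Integration.integrable_bound)
      show "integrable lborel (\<lambda>\<xi>. 2 * ?c * norm (fourier f \<xi>))"
        using integrable_fourier_schwartz[OF f] by simp
      show "AE \<xi> in lborel. norm (\<integral>\<tau>. norm (case (\<xi>, \<tau>) of (\<xi>, \<tau>) \<Rightarrow> ?H \<tau> \<xi>) \<partial>lborel) \<le> norm (2 * ?c * norm (fourier f \<xi>))"
        using bound by (auto simp only: prod.case intro!: AE_I2)
    qed measurable
  qed measurable
  have "(\<integral>\<tau>. of_real (\<tau> powr (s - 1) * indicator {0<..} \<tau>) *
         (\<integral>z. of_real (gauss z - gauss (z - (1 / \<tau>) *\<^sub>R y)) * abs_D_powr s f (x - \<tau> *\<^sub>R z) \<partial>lborel) \<partial>lborel)
      = (\<integral>\<tau>. (\<integral>\<xi>. ?H \<tau> \<xi> \<partial>lborel) \<partial>lborel)"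
  proof (rule Bochner_Integration.integral_cong[OF refl])
    fix \<tau> :: real
    show "of_real (\<tau> powr (s - 1) * indicator {0<..} \<tau>) *
         (\<integral>z. of_real (gauss z - gauss (z - (1 / \<tau>) *\<^sub>R y)) * abs_D_powr s f (x - \<tau> *\<^sub>R z) \<partial>lborel) = (\<integral>\<xi>. ?H \<tau> \<xi> \<partial>lborel)"
    proof (cases "0 < \<tau>")
      case True
      show ?thesis
        unfolding F gauss_difference_inverse_fourier[OF \<phi> True] integral_mult_right_zero[symmetric]
        using True by (intro Bochner_Integration.integral_cong refl) (simp add: mult_ac)
    qed simp
  qed
  also have "\<dots> = (\<integral>\<xi>. (\<integral>\<tau>. ?H \<tau> \<xi> \<partial>lborel) \<partial>lborel)"
    using lborel_pair.Fubini_integral[OF int] by simp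
  also have "\<dots> = (\<integral>\<xi>. of_real ?c * (fourier f \<xi> * cis (2 * pi * (x \<bullet> \<xi>)) - fourier f \<xi> * cis (2 * pi * ((x - y) \<bullet> \<xi>))) \<partial>lborel)"
  proof (rule integral_cong_AE)
    have "AE \<xi> in lborel. \<xi> \<noteq> (0 :: 'a)"
      by (rule AE_lborel_singleton)
    then show "AE \<xi> in lborel. (\<integral>\<tau>. ?H \<tau> \<xi> \<partial>lborel)
        = of_real ?c * (fourier f \<xi> * cis (2 * pi * (x \<bullet> \<xi>)) - fourier f \<xi> * cis (2 * pi * ((x - y) \<bullet> \<xi>)))"
    proof eventually_elim
      case (elim \<xi>)
      have "(\<integral>\<tau>. ?H \<tau> \<xi> \<partial>lborel) = of_real (\<integral>\<tau>. ?K \<tau> \<xi> \<partial>lborel) * (\<phi> \<xi> * ?E \<xi>)"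
        by (simp only: integral_mult_left_zero integral_complex_of_real)
      also have "\<dots> = of_real (norm \<xi> powr (- s) * norm \<xi> powr s) * (of_real ?c * (fourier f \<xi> * ?E \<xi>))"
        unfolding K1(2)[OF elim] \<phi>_def of_real_mult by (simp only: mult_ac)
      also have "norm \<xi> powr (- s) * norm \<xi> powr s = 1"
        using elim by (simp add: powr_minus)
      finally show ?case by (simp add: right_diff_distrib)
    qed
  qed measurable
  also have "\<dots> = of_real ?c * (inverse_fourier (fourier f) x - inverse_fourier (fourier f) (x - y))"
    using integrable_fourier_schwartz[OF f]
    by (simp add: inverse_fourier_lborel integrable_mult_cis)
  finally show ?thesis
    by (simp add: schwartz_inversion[OF f])
qed

text \<open>The factor 3 comes from \<open>integral_gauss_modulus\<close>, the bracket from
  \<open>nn_integral_powr_min\<close>, and the denominator from solving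
  \<open>schwartz_difference_representation\<close> for the difference.\<close>

definition modulus_const :: "real \<Rightarrow> real" where
  "modulus_const s = 3 * (1 / s + 1 / (1 - s)) / enn2real (subordination_const s)"

lemma modulus_const_pos: "0 < s \<Longrightarrow> s < 1 \<Longrightarrow> 0 < modulus_const s"
  using subordination_const_pos[of s] subordination_const_finite[of s]
  by (auto simp: modulus_const_def enn2real_positive_iff intro!: divide_pos_pos add_pos_pos mult_pos_pos)

text \<open>The absolute kernel in (\<tau>, z) becomes the density of a finite measure N, and
  \<open>?c\<close> |f(x) - f(x - y)| is at most the N-integral of translates of the modulus of
  |D|^s f. Each translate obeys the same bound A, so Minkowski gives A times the mass of N.\<close>

lemma Lp_le_modulus:
  fixes f :: "'a::euclidean_space \<Rightarrow> complex"
  assumes f: "f \<in> schwartz" and s: "0 < s" "s < 1" and p: "1 \<le> p" and A: "0 \<le> A"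
    and F: "Lp_le lborel p (\<lambda>x. norm (abs_D_powr s f x)) A"
  shows "Lp_le lborel p (\<lambda>x. norm (f x - f (x - y))) (modulus_const s * norm y powr s * A)"
proof (cases "y = 0")
  case True
  then show ?thesis using p by (auto simp: Lp_le_def)
next
  case False
  let ?c = "enn2real (subordination_const s)"
  let ?F = "abs_D_powr s f"
  have c: "0 < ?c"
    using subordination_const_pos[of s] subordination_const_finite[OF s] by (simp add: enn2real_positive_iff)
  note [measurable] = schwartz_measurable[OF f]
  have \<phi>: "integrable lborel (\<lambda>\<xi>. of_real (norm \<xi> powr s) * fourier f \<xi>)"
    by (rule integrable_powr_fourier_schwartz[OF f s])
  have F_def: "?F = inverse_fourier (\<lambda>\<xi>. of_real (norm \<xi> powr s) * fourier f \<xi>)"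
    by (simp add: abs_D_powr_def fourier_multiplier_def)
  have [measurable]: "?F \<in> borel_measurable borel"
    unfolding F_def by measurable
  \<comment> \<open>A uniform bound on |D|^s f; it serves integrability under N and does not enter
    the final constant.\<close>
  define K where "K = (\<integral>\<xi>. norm (of_real (norm \<xi> powr s) * fourier f \<xi>) \<partial>lborel)"
  have K: "norm (?F x) \<le> K" for x
    unfolding F_def K_def by (rule norm_inverse_fourier_le[OF \<phi>])
  let ?k = "\<lambda>(\<tau>::real, z::'a). \<tau> powr (s - 1) * indicator {0<..} \<tau> * \<bar>gauss z - gauss (z - (1 / \<tau>) *\<^sub>R y)\<bar>"
  define N where "N = density (lborel \<Otimes>\<^sub>M lborel) (\<lambda>w. ennreal (?k w))"
  define m where "m = 3 * (norm y powr s * (1 / s + 1 / (1 - s)))"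
  have m: "0 < m" using s False by (auto simp: m_def intro!: mult_pos_pos add_pos_pos)
  have k0: "0 \<le> ?k w" for w by (auto split: prod.split)
  have mass: "emeasure N (space N) \<le> ennreal m"
  proof -
    have "emeasure N (space N) = (\<integral>\<^sup>+ w. ennreal (?k w) * indicator (space (lborel \<Otimes>\<^sub>M lborel)) w \<partial>(lborel \<Otimes>\<^sub>M lborel))"
      unfolding N_def space_density by (intro emeasure_density sets.top) measurable
    also have "\<dots> = (\<integral>\<^sup>+ w. ennreal (?k w) \<partial>(lborel \<Otimes>\<^sub>M lborel))"
      by (intro nn_integral_cong) (simp add: space_pair_measure)
    also have "\<dots> = (\<integral>\<^sup>+ \<tau>. \<integral>\<^sup>+ z. ennreal (?k (\<tau>, z)) \<partial>lborel \<partial>lborel)"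
      by (rule lborel.nn_integral_fst[symmetric]) measurable
    also have "\<dots> \<le> (\<integral>\<^sup>+ \<tau>. ennreal 3 * (ennreal (\<tau> powr (s - 1) * min 1 (norm y / \<tau>)) * indicator {0<..} \<tau>) \<partial>lborel)"
    proof (rule nn_integral_mono)
      fix \<tau> :: real
      show "(\<integral>\<^sup>+ z. ennreal (?k (\<tau>, z)) \<partial>lborel) \<le> ennreal 3 * (ennreal (\<tau> powr (s - 1) * min 1 (norm y / \<tau>)) * indicator {0<..} \<tau>)"
      proof (cases "0 < \<tau>")
        case True
        have "(\<integral>\<^sup>+ z. ennreal (?k (\<tau>, z)) \<partial>lborel)
            = (\<integral>\<^sup>+ z. ennreal (\<tau> powr (s - 1)) * ennreal \<bar>gauss z - gauss (z - (1 / \<tau>) *\<^sub>R y)\<bar> \<partial>lborel)"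
          using True by (simp add: ennreal_mult)
        also have "\<dots> = ennreal (\<tau> powr (s - 1)) * (\<integral>\<^sup>+ z. ennreal \<bar>gauss z - gauss (z - (1 / \<tau>) *\<^sub>R y)\<bar> \<partial>lborel)"
          by (rule nn_integral_cmult) measurable
        also have "\<dots> \<le> ennreal (\<tau> powr (s - 1)) * ennreal (3 * min 1 (norm ((1 / \<tau>) *\<^sub>R y)))"
          by (intro mult_left_mono integral_gauss_modulus) simp
        also have "\<dots> = ennreal 3 * (ennreal (\<tau> powr (s - 1) * min 1 (norm y / \<tau>)) * indicator {0<..} \<tau>)"
          using True by (simp add: ennreal_mult[symmetric] mult_ac del: ennreal_numeral)
        finally show ?thesis .
      qed simp
    qed
    also have "\<dots> = ennreal 3 * (\<integral>\<^sup>+ \<tau>. ennreal (\<tau> powr (s - 1) * min 1 (norm y / \<tau>)) * indicator {0<..} \<tau> \<partial>lborel)"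
      by (rule nn_integral_cmult) measurable
    also have "\<dots> \<le> ennreal 3 * ennreal (norm y powr s * (1 / s + 1 / (1 - s)))"
      using False by (intro mult_left_mono nn_integral_powr_min s) auto
    also have "\<dots> = ennreal m"
      using s by (simp add: m_def ennreal_mult[symmetric] add_nonneg_nonneg del: ennreal_numeral)
    finally show ?thesis .
  qed
  then have fin: "finite_measure N"
    by (intro finite_measureI) (auto simp: top_unique)
  have setsN [measurable_cong]: "sets N = sets (borel \<Otimes>\<^sub>M borel)"
    by (simp add: N_def cong: sets_pair_measure_cong)
  interpret finite_measure N by fact
  interpret pair_sigma_finite "lborel :: 'a measure" N ..
  let ?h = "\<lambda>(x, (\<tau>, z)). norm (?F (x - \<tau> *\<^sub>R z))"
  have "Lp_le lborel p (\<lambda>x. \<integral>w. ?h (x, w) \<partial>N) (m * A)"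
  proof (rule Lp_le_integral)
    show "?h \<in> borel_measurable (lborel \<Otimes>\<^sub>M N)" by measurable
    show "0 \<le> ?h w" "?h w \<le> K" for w using K by (auto split: prod.split)
    show "Lp_le lborel p (\<lambda>x. ?h (x, w)) A" for w
      using Lp_le_translate[OF _ F, of "fst w *\<^sub>R snd w"] by (simp add: case_prod_unfold)
  qed (use mass m p A in auto)
  then have "Lp_le lborel p (\<lambda>x. (1 / ?c) * (\<integral>w. ?h (x, w) \<partial>N)) ((1 / ?c) * (m * A))"
    using c m A by (intro Lp_le_cmult) (auto intro!: borel_measurable_lebesgue_integral integral_nonneg_AE split: prod.split)
  moreover have "norm (f x - f (x - y)) \<le> (1 / ?c) * (\<integral>w. ?h (x, w) \<partial>N)" for x
  proof -
    have int: "integrable N (\<lambda>w. ?h (x, w))"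
      using K by (intro integrable_const_bound[of _ K]) (auto split: prod.split)
    have kM: "(\<lambda>w. ennreal (?k w)) \<in> borel_measurable (lborel \<Otimes>\<^sub>M lborel)"
      by measurable
    have hM: "(\<lambda>w. ennreal (?h (x, w))) \<in> borel_measurable (lborel \<Otimes>\<^sub>M lborel)"
      unfolding prod.case by measurable
    have "ennreal (?c * norm (f x - f (x - y))) = ennreal (norm (of_real ?c * (f x - f (x - y))))"
      using c by (simp add: norm_mult)
    also have "\<dots> \<le> (\<integral>\<^sup>+ \<tau>. ennreal (norm (complex_of_real (\<tau> powr (s - 1) * indicator {0<..} \<tau>) *
         (\<integral>z. of_real (gauss z - gauss (z - (1 / \<tau>) *\<^sub>R y)) * ?F (x - \<tau> *\<^sub>R z) \<partial>lborel))) \<partial>lborel)"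
      unfolding schwartz_difference_representation[OF f s]
      by (rule norm_integral_le_nn)
    also have "\<dots> \<le> (\<integral>\<^sup>+ \<tau>. \<integral>\<^sup>+ z. ennreal (?k (\<tau>, z)) * ennreal (?h (x, \<tau>, z)) \<partial>lborel \<partial>lborel)"
    proof (rule nn_integral_mono)
      fix \<tau> :: real
      let ?a = "\<tau> powr (s - 1) * indicator {0<..} \<tau>"
      have "ennreal (norm (complex_of_real ?a * (\<integral>z. of_real (gauss z - gauss (z - (1 / \<tau>) *\<^sub>R y)) * ?F (x - \<tau> *\<^sub>R z) \<partial>lborel)))
          = ennreal ?a * ennreal (norm (\<integral>z. of_real (gauss z - gauss (z - (1 / \<tau>) *\<^sub>R y)) * ?F (x - \<tau> *\<^sub>R z) \<partial>lborel))"
        by (simp add: norm_mult abs_mult ennreal_mult)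
      also have "\<dots> \<le> ennreal ?a * (\<integral>\<^sup>+ z. ennreal (norm (of_real (gauss z - gauss (z - (1 / \<tau>) *\<^sub>R y)) * ?F (x - \<tau> *\<^sub>R z))) \<partial>lborel)"
        by (intro mult_left_mono norm_integral_le_nn) simp
      also have "\<dots> = (\<integral>\<^sup>+ z. ennreal ?a * ennreal (norm (of_real (gauss z - gauss (z - (1 / \<tau>) *\<^sub>R y)) * ?F (x - \<tau> *\<^sub>R z))) \<partial>lborel)"
        by (rule nn_integral_cmult[symmetric]) measurable
      also have "\<dots> = (\<integral>\<^sup>+ z. ennreal (?k (\<tau>, z)) * ennreal (?h (x, \<tau>, z)) \<partial>lborel)"
        by (intro nn_integral_cong) (simp add: ennreal_mult[symmetric] norm_mult mult.assoc del: of_real_diff)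
      finally show "ennreal (norm (complex_of_real ?a * (\<integral>z. of_real (gauss z - gauss (z - (1 / \<tau>) *\<^sub>R y)) * ?F (x - \<tau> *\<^sub>R z) \<partial>lborel)))
        \<le> (\<integral>\<^sup>+ z. ennreal (?k (\<tau>, z)) * ennreal (?h (x, \<tau>, z)) \<partial>lborel)" .
    qed
    also have "\<dots> = (\<integral>\<^sup>+ w. ennreal (?k w) * ennreal (?h (x, w)) \<partial>(lborel \<Otimes>\<^sub>M lborel))"
      by (intro lborel.nn_integral_fst borel_measurable_times_ennreal kM hM)
    also have "\<dots> = (\<integral>\<^sup>+ w. ennreal (?h (x, w)) \<partial>N)"
      unfolding N_def by (intro nn_integral_density[symmetric] kM hM)
    also have "\<dots> = ennreal (\<integral>w. ?h (x, w) \<partial>N)"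
      using int by (intro nn_integral_eq_integral) (auto split: prod.split)
    finally have "?c * norm (f x - f (x - y)) \<le> (\<integral>w. ?h (x, w) \<partial>N)"
      by (subst (asm) ennreal_le_iff) (auto intro!: integral_nonneg_AE split: prod.split)
    then show ?thesis using c by (simp add: field_simps)
  qed
  ultimately have "Lp_le lborel p (\<lambda>x. norm (f x - f (x - y))) ((1 / ?c) * (m * A))"
    by (rule Lp_le_mono) auto
  moreover have "(1 / ?c) * (m * A) = modulus_const s * norm y powr s * A"
    unfolding m_def modulus_const_def by (simp only: divide_inverse mult_1_left mult_ac)
  ultimately show ?thesis by simp
qed

section \<open>The commutator estimate\<close>

lemma Lp_norm_Lp_le:
  assumes [measurable]: "h \<in> borel_measurable borel" and p: "1 \<le> p"
    and a: "Lp_norm p h = ennreal a" "0 \<le> a"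
  shows "Lp_le lborel p (\<lambda>x. norm (h x)) a"
proof (cases rule: ennreal_ge_1_cases[OF p])
  case 1
  have "AE x in lebesgue. ennreal (norm (h x)) \<le> ennreal a"
    using esssup_AE[of "\<lambda>x. ennreal (norm (h x))" lebesgue] a 1 by (simp add: Lp_norm_def)
  then show ?thesis
    using 1 a by (simp add: Lp_le_def AE_completion_iff)
next
  case 2
  let ?t = "enn2real p" and ?I = "\<integral>\<^sup>+ x. ennreal (norm (h x) powr enn2real p) \<partial>lborel"
  have eq: "ennreal_powr ?I (1 / ?t) = ennreal a"
    using a 2 by (simp add: Lp_norm_def nn_integral_completion)
  then have "?I \<noteq> \<infinity>"
    by (auto simp: ennreal_powr_def)
  then have "enn2real ?I powr (1 / ?t) = a"
    using eq a by (simp add: ennreal_powr_def ennreal_inj)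
  then have "a powr ?t = enn2real ?I"
    using 2 by (auto simp: powr_powr)
  then show ?thesis
    using 2 \<open>?I \<noteq> \<infinity>\<close> by (simp add: Lp_le_def ennreal_enn2real_if)
qed

lemma Lp_norm_le:
  assumes [measurable]: "h \<in> borel_measurable borel" and p: "1 \<le> p" and B: "0 \<le> B"
    and le: "Lp_le lborel p (\<lambda>x. norm (h x)) B"
  shows "Lp_norm p h \<le> ennreal B"
proof (cases rule: ennreal_ge_1_cases[OF p])
  case 1
  have "AE x in lborel. ennreal (norm (h x)) \<le> ennreal B"
    using le 1 by (auto simp: Lp_le_def elim!: eventually_mono intro: ennreal_leI)
  then have "esssup lebesgue (\<lambda>x. ennreal (norm (h x))) \<le> ennreal B"
    by (intro esssup_I AE_completion) (auto intro: measurable_completion)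
  then show ?thesis using 1 by (simp add: Lp_norm_def)
next
  case 2
  let ?t = "enn2real p" and ?I = "\<integral>\<^sup>+ x. ennreal (norm (h x) powr enn2real p) \<partial>lborel"
  have I: "?I \<le> ennreal (B powr ?t)"
    using le 2 by (simp add: Lp_le_def)
  then have fin: "?I \<noteq> \<infinity>" by (auto simp: top_unique)
  have "enn2real ?I \<le> B powr ?t"
    using I by (simp add: enn2real_leI)
  then have "enn2real ?I powr (1 / ?t) \<le> (B powr ?t) powr (1 / ?t)"
    using 2 by (intro powr_mono2) auto
  also have "\<dots> = B" using 2 B by (simp add: powr_powr)
  finally show ?thesis
    using fin 2 by (simp add: Lp_norm_def nn_integral_completion ennreal_powr_def ennreal_leI)
qed

lemma Lp_le_0_AE:
  assumes [measurable]: "h \<in> borel_measurable M" and p: "1 \<le> p" and h: "\<And>x. 0 \<le> h x" "Lp_le M p h 0"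
  shows "AE x in M. h x = 0"
proof (cases rule: ennreal_ge_1_cases[OF p])
  case 1
  then show ?thesis
    using h by (auto simp: Lp_le_def elim!: eventually_mono intro: antisym)
next
  case 2
  have "(\<integral>\<^sup>+ x. ennreal (h x powr enn2real p) \<partial>M) = 0"
    using h(2) 2 by (simp add: Lp_le_def)
  then show ?thesis
    by (subst (asm) nn_integral_0_iff_AE) (auto elim!: eventually_mono)
qed

text \<open>The set where G exceeds c is open and null, hence empty. This upgrades essential bounds
  on differences of f to bounds at every point.\<close>

lemma continuous_AE_le_imp_le:
  fixes G :: "'a::euclidean_space \<Rightarrow> real"
  assumes cont: "continuous_on UNIV G" and le: "AE x in lborel. G x \<le> c"
  shows "G x \<le> c"
proof (rule ccontr)
  assume *: "\<not> G x \<le> c"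
  have o: "open {x. c < G x}"
    using cont by (intro open_Collect_less continuous_intros) auto
  have "{x. c < G x} \<in> null_sets lborel"
    using le o by (subst AE_iff_null_sets) (auto simp: not_less)
  then have "negligible {x. c < G x}"
    by (simp add: negligible_iff_null_sets null_sets_completionI)
  then have "{x. c < G x} = {}"
    using open_not_negligible[OF o] by blast
  moreover have "x \<in> {x. c < G x}" using * by simp
  ultimately show False by blast
qed

section \<open>Scaling and the weighted mass of the kernel\<close>

lemma nn_integral_lebesgue_scale:
  fixes H :: "'a::euclidean_space \<Rightarrow> ennreal"
  assumes [measurable]: "H \<in> borel_measurable lebesgue" and c: "0 < c"
  shows "(\<integral>\<^sup>+ x. ennreal (c ^ DIM('a)) * H (c *\<^sub>R x) \<partial>lebesgue) = (\<integral>\<^sup>+ x. H x \<partial>lebesgue)"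
proof -
  have T: "(\<lambda>x. 0 + (\<Sum>j\<in>Basis. (c * (x \<bullet> j)) *\<^sub>R j)) = (\<lambda>x::'a. c *\<^sub>R x)"
    unfolding scaleR_scaleR[symmetric] scaleR_sum_right[symmetric] euclidean_representation by simp
  have L: "lebesgue = density (distr lebesgue lebesgue (\<lambda>x::'a. c *\<^sub>R x)) (\<lambda>_. ennreal (c ^ DIM('a)))"
    using lebesgue_affine_euclidean[of "\<lambda>_::'a. c" 0] c unfolding T by simp
  have "(\<integral>\<^sup>+ x. H x \<partial>lebesgue)
      = (\<integral>\<^sup>+ x. H x \<partial>density (distr lebesgue lebesgue (\<lambda>x::'a. c *\<^sub>R x)) (\<lambda>_. ennreal (c ^ DIM('a))))"
    using L by metis
  also have "\<dots> = (\<integral>\<^sup>+ x. ennreal (c ^ DIM('a)) * H x \<partial>distr lebesgue lebesgue (\<lambda>x::'a. c *\<^sub>R x))"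
    by (subst nn_integral_density) auto
  also have "\<dots> = (\<integral>\<^sup>+ x. ennreal (c ^ DIM('a)) * H (c *\<^sub>R x) \<partial>lebesgue)"
    by (subst nn_integral_distr) auto
  finally show ?thesis by simp
qed

text \<open>The origin of 2^(-k s): the dilation preserves L^1 mass, while the weight |y|^s is
  homogeneous of degree s. The change of variables is made for \<open>lebesgue\<close> because P
  need not be Borel.\<close>

lemma nn_integral_dyadic_dilation:
  fixes P :: "'a::euclidean_space \<Rightarrow> complex"
  assumes P: "P \<in> borel_measurable lebesgue"
  shows "(\<integral>\<^sup>+ y. ennreal (norm (dyadic_dilation k P y) * norm y powr s) \<partial>lebesgue)
    = ennreal (2 powr (- (real_of_int k * s))) * (\<integral>\<^sup>+ y. ennreal (norm (P y) * norm y powr s) \<partial>lebesgue)"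
proof -
  define c :: real where "c = 2 powi k"
  have c: "0 < c" by (simp add: c_def)
  have c2: "c = 2 powr real_of_int k"
    by (simp add: c_def powr_real_of_int')
  let ?H = "\<lambda>y. ennreal (norm (P y) * norm y powr s)"
  have [measurable]: "?H \<in> borel_measurable lebesgue"
    using P by (intro measurable_compose[OF _ measurable_ennreal] borel_measurable_times) (auto intro: measurable_completion)
  have "(\<integral>\<^sup>+ y. ennreal (norm (dyadic_dilation k P y) * norm y powr s) \<partial>lebesgue)
      = (\<integral>\<^sup>+ y. ennreal (c powr (- s)) * (ennreal (c ^ DIM('a)) * ?H (c *\<^sub>R y)) \<partial>lebesgue)"
  proof (rule nn_integral_cong)
    fix y :: 'a
    have "norm (dyadic_dilation k P y) = c ^ DIM('a) * norm (P (c *\<^sub>R y))"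
      by (simp add: dyadic_dilation_def c_def norm_mult mult.commute[of "int DIM('a)"] power_int_mult norm_power norm_power_int)
    moreover have "norm y powr s = c powr (- s) * norm (c *\<^sub>R y) powr s"
      using c by (simp add: powr_mult powr_minus)
    ultimately show "ennreal (norm (dyadic_dilation k P y) * norm y powr s)
        = ennreal (c powr (- s)) * (ennreal (c ^ DIM('a)) * ?H (c *\<^sub>R y))"
      using c by (simp add: ennreal_mult[symmetric] mult_ac)
  qed
  also have "\<dots> = ennreal (c powr (- s)) * (\<integral>\<^sup>+ y. ennreal (c ^ DIM('a)) * ?H (c *\<^sub>R y) \<partial>lebesgue)"
    by (rule nn_integral_cmult) (intro borel_measurable_times_ennreal measurable_const
        measurable_compose[OF lebesgue_measurable_scaling \<open>?H \<in> borel_measurable lebesgue\<close>], simp)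
  also have "(\<integral>\<^sup>+ y. ennreal (c ^ DIM('a)) * ?H (c *\<^sub>R y) \<partial>lebesgue) = (\<integral>\<^sup>+ y. ?H y \<partial>lebesgue)"
    by (intro nn_integral_lebesgue_scale c) measurable
  also have "c powr (- s) = 2 powr (- (real_of_int k * s))"
    by (simp add: c2 powr_powr)
  finally show ?thesis .
qed

text \<open>On the annulus of outer radius 2^j the weight is at most 2^(j s), which leaves mass of
  order 2^(-j \<epsilon>), a geometric series. On the unit ball the weight is at most 1, so the
  integral there is at most the L^1 norm of P.\<close>

lemma nn_integral_dyadic_weight_finite:
  fixes P :: "'a::euclidean_space \<Rightarrow> complex"
  assumes P: "integrable lebesgue P" and s: "0 < s" and eps: "0 < \<epsilon>"
    and A: "\<And>j::nat. 1 \<le> j \<Longrightarrow> (LINT x:{x. 2 ^ (j - 1) \<le> norm x \<and> norm x \<le> 2 ^ j}|lebesgue. norm (P x))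
             \<le> A * 2 powr (- (real j * (\<epsilon> + s)))"
  shows "(\<integral>\<^sup>+ y. ennreal (norm (P y) * norm y powr s) \<partial>lebesgue) < \<infinity>"
proof -
  \<comment> \<open>Indexed from 0: \<open>?S j\<close> is the annulus of the hypothesis with index
    \<open>Suc j\<close>.\<close>
  let ?S = "\<lambda>j::nat. {x::'a. 2 ^ j \<le> norm x \<and> norm x \<le> 2 ^ Suc j}"
  have [measurable]: "P \<in> borel_measurable lebesgue" using P by (rule borel_measurable_integrable)
  have S: "?S j \<in> sets lebesgue" for j
    by (intro sets_completionI_sets) measurable
  have int: "integrable lebesgue (\<lambda>x. indicator (?S j) x *\<^sub>R norm (P x))" for j
    by (intro integrable_mult_indicator S integrable_norm P)
  have piece: "(\<integral>\<^sup>+ x. ennreal (2 powr (real (Suc j) * s)) * ennreal (indicator (?S j) x *\<^sub>R norm (P x)) \<partial>lebesgue)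
      \<le> ennreal (A * (2 powr (- \<epsilon>)) ^ Suc j)" for j
  proof -
    have "(\<integral>\<^sup>+ x. ennreal (2 powr (real (Suc j) * s)) * ennreal (indicator (?S j) x *\<^sub>R norm (P x)) \<partial>lebesgue)
      = ennreal (2 powr (real (Suc j) * s)) * (\<integral>\<^sup>+ x. ennreal (indicator (?S j) x *\<^sub>R norm (P x)) \<partial>lebesgue)"
      using int[of j] by (intro nn_integral_cmult) (auto dest: borel_measurable_integrable)
    also have "(\<integral>\<^sup>+ x. ennreal (indicator (?S j) x *\<^sub>R norm (P x)) \<partial>lebesgue)
        = ennreal (LINT x:?S j|lebesgue. norm (P x))"
      unfolding set_lebesgue_integral_def by (intro nn_integral_eq_integral int) simp
    also have "\<dots> \<le> ennreal (A * 2 powr (- (real (Suc j) * (\<epsilon> + s))))"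
      using A[of "Suc j"] by (intro ennreal_leI) simp
    also have "ennreal (2 powr (real (Suc j) * s)) * ennreal (A * 2 powr (- (real (Suc j) * (\<epsilon> + s))))
        = ennreal (2 powr (real (Suc j) * s) * (A * 2 powr (- (real (Suc j) * (\<epsilon> + s)))))"
      by (rule ennreal_mult'[symmetric]) simp
    also have "2 powr (real (Suc j) * s) * (A * 2 powr (- (real (Suc j) * (\<epsilon> + s)))) = A * (2 powr (- \<epsilon>)) ^ Suc j"
    proof -
      have "2 powr (real (Suc j) * s) * 2 powr (- (real (Suc j) * (\<epsilon> + s))) = 2 powr (real (Suc j) * (- \<epsilon>))"
        by (simp add: powr_add[symmetric] algebra_simps)
      also have "\<dots> = (2 powr (- \<epsilon>)) ^ Suc j"
        by (simp add: powr_realpow[symmetric] powr_powr mult.commute del: of_nat_Suc power_Suc)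
      finally show ?thesis by (simp add: mult_ac del: power_Suc)
    qed
    finally show ?thesis by (simp add: mult_left_mono)
  qed
  have "(\<integral>\<^sup>+ y. ennreal (norm (P y) * norm y powr s) \<partial>lebesgue)
      \<le> (\<integral>\<^sup>+ y. ennreal (norm (P y)) + (\<Sum>j. ennreal (2 powr (real (Suc j) * s)) * ennreal (indicator (?S j) y *\<^sub>R norm (P y))) \<partial>lebesgue)"
  proof (rule nn_integral_mono)
    fix y :: 'a
    show "ennreal (norm (P y) * norm y powr s)
      \<le> ennreal (norm (P y)) + (\<Sum>j. ennreal (2 powr (real (Suc j) * s)) * ennreal (indicator (?S j) y *\<^sub>R norm (P y)))"
    proof (cases "norm y \<le> 1")
      case True
      then have "norm (P y) * norm y powr s \<le> norm (P y)"
        using s by (simp add: mult_left_le powr_le1)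
      then show ?thesis by (intro add_increasing2) (auto intro: ennreal_leI)
    next
      case False
      \<comment> \<open>The least n selects an annulus containing y: it is positive since |y| > 1,
        and minimality gives the inner bound.\<close>
      define n where "n = (LEAST n. norm y \<le> 2 ^ n)"
      have ex: "\<exists>n. norm y \<le> 2 ^ n"
        using real_arch_pow[of 2 "norm y"] by (auto intro: less_imp_le)
      then have n: "norm y \<le> 2 ^ n" unfolding n_def by (rule LeastI_ex)
      then obtain j where j: "n = Suc j" using False by (cases n) auto
      have "\<not> norm y \<le> 2 ^ j"
        using not_less_Least[of j "\<lambda>n. norm y \<le> 2 ^ n"] j unfolding n_def by simp
      then have mem: "y \<in> ?S j" using n j by simp
      have "norm y powr s \<le> (2 ^ Suc j) powr s"
        using mem s by (intro powr_mono2) auto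
      also have "\<dots> = 2 powr (real (Suc j) * s)"
        by (simp add: powr_realpow[symmetric] powr_powr del: of_nat_Suc power_Suc)
      finally have "ennreal (norm (P y) * norm y powr s)
          \<le> ennreal (2 powr (real (Suc j) * s) * norm (P y))"
        by (intro ennreal_leI) (simp add: mult.commute mult_left_mono)
      also have "\<dots> = (\<Sum>j\<in>{j}. ennreal (2 powr (real (Suc j) * s)) * ennreal (indicator (?S j) y *\<^sub>R norm (P y)))"
        using mem by (simp add: ennreal_mult)
      also have "\<dots> \<le> (\<Sum>j. ennreal (2 powr (real (Suc j) * s)) * ennreal (indicator (?S j) y *\<^sub>R norm (P y)))"
        by (intro sum_le_suminf summableI) auto
      finally show ?thesis by (intro add_increasing) auto
    qed
  qed
  also have "\<dots> = (\<integral>\<^sup>+ y. ennreal (norm (P y)) \<partial>lebesgue)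
      + (\<integral>\<^sup>+ y. (\<Sum>j. ennreal (2 powr (real (Suc j) * s)) * ennreal (indicator (?S j) y *\<^sub>R norm (P y))) \<partial>lebesgue)"
    using int by (intro nn_integral_add) (auto intro!: borel_measurable_suminf_order dest!: borel_measurable_integrable)
  also have "(\<integral>\<^sup>+ y. (\<Sum>j. ennreal (2 powr (real (Suc j) * s)) * ennreal (indicator (?S j) y *\<^sub>R norm (P y))) \<partial>lebesgue)
      = (\<Sum>j. \<integral>\<^sup>+ y. ennreal (2 powr (real (Suc j) * s)) * ennreal (indicator (?S j) y *\<^sub>R norm (P y)) \<partial>lebesgue)"
  proof (rule nn_integral_suminf)
    fix j
    have "(\<lambda>x. indicator (?S j) x *\<^sub>R norm (P x)) \<in> borel_measurable lebesgue"
      using int by (rule borel_measurable_integrable)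
    then show "(\<lambda>y. ennreal (2 powr (real (Suc j) * s)) * ennreal (indicator (?S j) y *\<^sub>R norm (P y))) \<in> borel_measurable lebesgue"
      by measurable
  qed
  also have "\<dots> \<le> (\<Sum>j. ennreal (A * (2 powr (- \<epsilon>)) ^ Suc j))"
    by (intro suminf_le piece summableI)
  \<comment> \<open>The absolute value makes the terms nonnegative whatever the sign of A, so that
    the series in \<open>ennreal\<close> is the image of a real one.\<close>
  also have "\<dots> \<le> (\<Sum>j. ennreal (\<bar>A\<bar> * (2 powr (- \<epsilon>)) ^ Suc j))"
    by (intro suminf_le summableI ennreal_leI mult_right_mono) auto
  also have "\<dots> = ennreal (\<Sum>j. \<bar>A\<bar> * (2 powr (- \<epsilon>)) ^ Suc j)"
  proof (rule suminf_ennreal2)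
    have "2 powr (- \<epsilon>) < 1" using eps by (simp add: powr_less_one)
    then have "summable (\<lambda>j. (2 powr (- \<epsilon>)) ^ j)" by (intro summable_geometric) simp
    then show "summable (\<lambda>j. \<bar>A\<bar> * (2 powr (- \<epsilon>)) ^ Suc j)"
      by (intro summable_mult) (subst summable_Suc_iff)
  qed simp
  also have "(\<integral>\<^sup>+ y. ennreal (norm (P y)) \<partial>lebesgue) + ennreal (\<Sum>j. \<bar>A\<bar> * (2 powr (- \<epsilon>)) ^ Suc j) < \<infinity>"
    using P by (simp add: integrable_iff_bounded)
  finally show ?thesis by (simp add: add_left_mono)
qed

section \<open>The estimate for a general kernel\<close>

lemma completion_ex_borel_measurable_complex:
  fixes g :: "'a \<Rightarrow> complex"
  assumes g: "g \<in> borel_measurable (completion M)"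
  obtains g' where "g' \<in> borel_measurable M" "AE x in M. g x = g' x"
proof -
  have "(\<lambda>x. Re (g x)) \<in> borel_measurable (completion M)" "(\<lambda>x. Im (g x)) \<in> borel_measurable (completion M)"
    using g by auto
  then obtain u v where uv [measurable]: "u \<in> borel_measurable M" "v \<in> borel_measurable M"
    and AE: "AE x in M. Re (g x) = u x" "AE x in M. Im (g x) = v x"
    using completion_ex_borel_measurable_real by metis
  show ?thesis
  proof
    show "(\<lambda>x. of_real (u x) + \<i> * of_real (v x)) \<in> borel_measurable M" by measurable
    show "AE x in M. g x = of_real (u x) + \<i> * of_real (v x)"
      using AE by eventually_elim (simp add: complex_eq_iff)
  qed
qed

text \<open>Kept for an arbitrary kernel: a dilate of P enters the estimate only through its
  measurability and its mass with weight |y|^s.\<close>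

definition commutator_avg where
  "commutator_avg Q f g x = (LINT y|lebesgue. Q y * (f x - f (x - y)) * g (x - y))"

lemma dyadic_dilation_measurable:
  fixes P :: "'a::euclidean_space \<Rightarrow> complex"
  assumes "P \<in> borel_measurable lebesgue"
  shows "dyadic_dilation k P \<in> borel_measurable lebesgue"
  unfolding dyadic_dilation_def[abs_def]
  by (intro borel_measurable_times measurable_const measurable_compose[OF lebesgue_measurable_scaling assms]) simp

text \<open>Minkowski with respect to |Q(y)| |y|^s dy is applied to h(x, y) = |y|^(-s) |f(x) - f(x -
  y)| |g(x - y)|. For fixed y the modulus of continuity cancels |y|^(-s), and Hoelder gives an L^r
  bound that is uniform in y.\<close>

lemma Lp_le_commutator_avg:
  fixes Q f g :: "'a::euclidean_space \<Rightarrow> complex"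
  assumes Q: "Q \<in> borel_measurable lebesgue"
    and mass: "(\<integral>\<^sup>+ y. ennreal (norm (Q y) * norm y powr s) \<partial>lebesgue) \<le> ennreal m" "0 < m"
    and f: "f \<in> schwartz" and g: "g \<in> schwartz" and s: "0 < s" "s < 1"
    and pqr: "1 \<le> p" "1 \<le> q" "1 \<le> r" "1 / p + 1 / q = 1 / r"
    and A: "0 < A" "Lp_le lborel p (\<lambda>x. norm (abs_D_powr s f x)) A"
    and B: "0 < B" "Lp_le lborel q (\<lambda>x. norm (g x)) B"
  shows "Lp_norm r (commutator_avg Q f g) \<le> ennreal (m * (modulus_const s * A * B))"
proof -
  note [measurable] = schwartz_measurable[OF f] schwartz_measurable[OF g]
  let ?C = "modulus_const s"
  have C: "0 < ?C" by (rule modulus_const_pos[OF s])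
  \<comment> \<open>With a Borel representative of Q, the weighted measure and all joint
    measurability live on Borel sets.\<close>
  obtain Q' where Q' [measurable]: "Q' \<in> borel_measurable lborel" and QQ': "AE y in lborel. Q y = Q' y"
    using completion_ex_borel_measurable_complex[OF Q] .
  have T: "commutator_avg Q f g = (\<lambda>x. \<integral>y. Q' y * (f x - f (x - y)) * g (x - y) \<partial>lborel)"
  proof
    fix x
    have "commutator_avg Q f g x = (LINT y|lebesgue. Q' y * (f x - f (x - y)) * g (x - y))"
      unfolding commutator_avg_def
    proof (rule integral_cong_AE)
      show "AE y in lebesgue. Q y * (f x - f (x - y)) * g (x - y) = Q' y * (f x - f (x - y)) * g (x - y)"
        using AE_completion[OF QQ'] by eventually_elim simp
      show "(\<lambda>y. Q y * (f x - f (x - y)) * g (x - y)) \<in> borel_measurable lebesgue"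
        by (intro borel_measurable_times Q) (auto intro!: measurable_completion)
    qed (auto intro!: measurable_completion)
    also have "\<dots> = (\<integral>y. Q' y * (f x - f (x - y)) * g (x - y) \<partial>lborel)"
      by (intro integral_completion) measurable
    finally show "commutator_avg Q f g x = \<dots>" .
  qed
  have [measurable]: "commutator_avg Q f g \<in> borel_measurable borel"
    unfolding T by measurable
  obtain Mf where Mf: "0 \<le> Mf" "norm (f x) \<le> Mf" for x using schwartz_bounded[OF f] by blast
  obtain Mg where Mg: "0 \<le> Mg" "norm (g x) \<le> Mg" for x using schwartz_bounded[OF g] by blast
  have \<phi>: "integrable lborel (\<lambda>\<xi>. of_real (norm \<xi> powr s) * fourier f \<xi>)"
    by (rule integrable_powr_fourier_schwartz[OF f s])
  define K where "K = (\<integral>\<xi>. norm (of_real (norm \<xi> powr s) * fourier f \<xi>) \<partial>lborel)"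
  have K: "norm (abs_D_powr s f x) \<le> K" for x
    unfolding abs_D_powr_def fourier_multiplier_def K_def by (rule norm_inverse_fourier_le[OF \<phi>])
  have K0: "0 \<le> K" by (simp add: K_def)
  \<comment> \<open>The case p = \<infinity> of the modulus estimate, made pointwise by continuity.
    It serves only to bound h, as \<open>Lp_le_integral\<close> demands; K does not reach the final
    constant.\<close>
  have sup: "norm (f x - f (x - y)) \<le> ?C * norm y powr s * K" for x y
  proof (rule continuous_AE_le_imp_le[of "\<lambda>x. norm (f x - f (x - y))"])
    show "continuous_on UNIV (\<lambda>x. norm (f x - f (x - y)))"
      using schwartz_continuous[OF f]
      by (intro continuous_intros continuous_on_compose2[OF schwartz_continuous[OF f]]) auto
    have "Lp_le lborel \<infinity> (\<lambda>x. norm (f x - f (x - y))) (?C * norm y powr s * K)"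
      using K K0 by (intro Lp_le_modulus f s) (auto simp: Lp_le_def)
    then show "AE x in lborel. norm (f x - f (x - y)) \<le> ?C * norm y powr s * K"
      by (simp add: Lp_le_def)
  qed
  \<comment> \<open>At y = 0 the convention \<open>0 powr (- s) = 0\<close> gives h = 0, in
    accordance with the vanishing difference.\<close>
  define h where "h = (\<lambda>(x, y). norm y powr (- s) * (norm (f x - f (x - y)) * norm (g (x - y))))"
  have [measurable]: "h \<in> borel_measurable (borel \<Otimes>\<^sub>M borel)" unfolding h_def by measurable
  have h0: "0 \<le> h w" for w by (auto simp: h_def split: prod.split)
  have hK: "h w \<le> ?C * K * Mg" for w
  proof -
    obtain x y where w: "w = (x, y)" by force
    have "norm y powr (- s) * (norm (f x - f (x - y)) * norm (g (x - y)))
        \<le> norm y powr (- s) * ((?C * norm y powr s * K) * Mg)"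
      using C K0 by (intro mult_left_mono mult_mono sup Mg) auto
    also have "\<dots> = (norm y powr (- s) * norm y powr s) * (?C * K * Mg)" by simp
    also have "\<dots> \<le> 1 * (?C * K * Mg)"
    proof (rule mult_right_mono)
      show "norm y powr (- s) * norm y powr s \<le> 1"
        by (cases "y = 0") (auto simp: powr_minus)
      show "0 \<le> ?C * K * Mg" using C K0 Mg by simp
    qed
    finally show ?thesis by (simp add: h_def w)
  qed
  have hL: "Lp_le lborel r (\<lambda>x. h (x, y)) (?C * A * B)" for y
  proof (cases "y = 0")
    case True
    then show ?thesis using C A B by (auto simp: h_def Lp_le_def)
  next
    case False
    have "Lp_le lborel r (\<lambda>x. norm (f x - f (x - y)) * norm (g (x - y))) (?C * norm y powr s * A * B)"
    proof (rule Lp_le_mult[OF _ _ _ _ _ B(1) pqr])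
      show "Lp_le lborel p (\<lambda>x. norm (f x - f (x - y))) (?C * norm y powr s * A)"
        using A by (intro Lp_le_modulus f s pqr) auto
      show "Lp_le lborel q (\<lambda>x. norm (g (x - y))) B"
        by (rule Lp_le_translate[OF _ B(2)]) measurable
    qed (use C A False in auto)
    then have "Lp_le lborel r (\<lambda>x. h (x, y)) (norm y powr (- s) * (?C * norm y powr s * A * B))"
      unfolding h_def prod.case using C A B by (intro Lp_le_cmult) auto
    then show ?thesis
      using False by (simp add: powr_minus field_simps)
  qed
  define N where "N = density lborel (\<lambda>y. ennreal (norm (Q' y) * norm y powr s))"
  have massN: "emeasure N (space N) \<le> ennreal m"
  proof -
    have "emeasure N (space N) = (\<integral>\<^sup>+ y. ennreal (norm (Q' y) * norm y powr s) \<partial>lborel)"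
      by (simp add: N_def emeasure_density)
    also have "\<dots> = (\<integral>\<^sup>+ y. ennreal (norm (Q y) * norm y powr s) \<partial>lborel)"
      using QQ' by (intro nn_integral_cong_AE) auto
    also have "\<dots> \<le> ennreal m"
      using mass by (simp add: nn_integral_completion)
    finally show ?thesis .
  qed
  then have "finite_measure N"
    by (intro finite_measureI) (auto simp: top_unique)
  then interpret finite_measure N .
  interpret pair_sigma_finite "lborel :: 'a measure" N ..
  have [measurable_cong]: "sets N = sets borel" by (simp add: N_def)
  have "Lp_le lborel r (\<lambda>x. \<integral>y. h (x, y) \<partial>N) (m * (?C * A * B))"
    using massN mass(2) pqr(3) C A B by (intro Lp_le_integral[of h "?C * K * Mg"] h0 hK hL) auto
  moreover have "norm (commutator_avg Q f g x) \<le> (\<integral>y. h (x, y) \<partial>N)" for x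
  proof -
    have int: "integrable N (\<lambda>y. h (x, y))"
      using h0 hK by (intro integrable_const_bound[of _ "?C * K * Mg"]) auto
    have "ennreal (norm (commutator_avg Q f g x)) \<le> (\<integral>\<^sup>+ y. ennreal (norm (Q' y * (f x - f (x - y)) * g (x - y))) \<partial>lborel)"
      unfolding T by (rule norm_integral_le_nn)
    also have "\<dots> = (\<integral>\<^sup>+ y. ennreal (norm (Q' y) * norm y powr s) * ennreal (h (x, y)) \<partial>lborel)"
    proof (rule nn_integral_cong)
      fix y
      have "norm (Q' y * (f x - f (x - y)) * g (x - y)) = norm (Q' y) * norm y powr s * h (x, y)"
        by (cases "y = 0") (auto simp: h_def norm_mult powr_minus)
      then show "ennreal (norm (Q' y * (f x - f (x - y)) * g (x - y)))
          = ennreal (norm (Q' y) * norm y powr s) * ennreal (h (x, y))"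
        using h0 by (simp add: ennreal_mult)
    qed
    also have "\<dots> = (\<integral>\<^sup>+ y. ennreal (h (x, y)) \<partial>N)"
      unfolding N_def by (rule nn_integral_density[symmetric]) measurable
    also have "\<dots> = ennreal (\<integral>y. h (x, y) \<partial>N)"
      using int h0 by (intro nn_integral_eq_integral) auto
    finally show ?thesis
      using h0 by (subst (asm) ennreal_le_iff) (auto intro!: integral_nonneg_AE)
  qed
  ultimately have "Lp_le lborel r (\<lambda>x. norm (commutator_avg Q f g x)) (m * (?C * A * B))"
    by (rule Lp_le_mono) auto
  then show ?thesis
    using mass C A B by (intro Lp_norm_le pqr) auto
qed

text \<open>Vanishing almost everywhere does not depend on the exponent, so a zero norm of |D|^s f
  can be fed into the modulus estimate with p = \<infinity> and bound 0, which makes f constant. A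
  zero norm of g makes the continuous function g vanish identically.\<close>

lemma commutator_avg_eq_0:
  fixes Q f g :: "'a::euclidean_space \<Rightarrow> complex"
  assumes f: "f \<in> schwartz" and g: "g \<in> schwartz" and s: "0 < s" "s < 1" and pq: "1 \<le> p" "1 \<le> q"
    and zero: "Lp_norm p (abs_D_powr s f) = 0 \<or> Lp_norm q g = 0"
  shows "commutator_avg Q f g = (\<lambda>x. 0)"
  using zero
proof
  note [measurable] = schwartz_measurable[OF f]
  assume "Lp_norm p (abs_D_powr s f) = 0"
  moreover have [measurable]: "abs_D_powr s f \<in> borel_measurable borel"
    unfolding abs_D_powr_def fourier_multiplier_def by measurable
  ultimately have "AE x in lborel. norm (abs_D_powr s f x) = 0"
    using Lp_norm_Lp_le[of "abs_D_powr s f" p 0] pq by (intro Lp_le_0_AE[OF _ pq(1)]) auto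
  then have *: "Lp_le lborel \<infinity> (\<lambda>x. norm (abs_D_powr s f x)) 0"
    by (auto simp: Lp_le_def)
  have "norm (f x - f (x - y)) \<le> 0" for x y
  proof (rule continuous_AE_le_imp_le[of "\<lambda>x. norm (f x - f (x - y))"])
    show "continuous_on UNIV (\<lambda>x. norm (f x - f (x - y)))"
      using schwartz_continuous[OF f]
      by (intro continuous_intros continuous_on_compose2[OF schwartz_continuous[OF f]]) auto
    show "AE x in lborel. norm (f x - f (x - y)) \<le> 0"
      using Lp_le_modulus[OF f s _ _ *, of y] by (simp add: Lp_le_def)
  qed
  then show ?thesis by (simp add: commutator_avg_def fun_eq_iff)
next
  note [measurable] = schwartz_measurable[OF g]
  assume "Lp_norm q g = 0"
  then have "AE x in lborel. norm (g x) = 0"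
    using Lp_norm_Lp_le[of g q 0] pq by (intro Lp_le_0_AE[OF _ pq(2)]) auto
  then have "norm (g x) \<le> 0" for x
    using schwartz_continuous[OF g] by (intro continuous_AE_le_imp_le continuous_intros) auto
  then show ?thesis by (simp add: commutator_avg_def fun_eq_iff)
qed

text \<open>\<open>Lp_le_commutator_avg\<close> asks for positive real bounds, whereas the norms may
  be 0 or \<infinity>; the case distinction bridges this gap.\<close>

lemma Lp_norm_commutator_avg:
  fixes Q f g :: "'a::euclidean_space \<Rightarrow> complex"
  assumes Q: "Q \<in> borel_measurable lebesgue"
    and mass: "(\<integral>\<^sup>+ y. ennreal (norm (Q y) * norm y powr s) \<partial>lebesgue) \<le> ennreal m" "0 < m"
    and f: "f \<in> schwartz" and g: "g \<in> schwartz" and s: "0 < s" "s < 1"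
    and pqr: "1 \<le> p" "1 \<le> q" "1 \<le> r" "1 / p + 1 / q = 1 / r"
  shows "Lp_norm r (commutator_avg Q f g)
    \<le> ennreal (m * modulus_const s) * Lp_norm p (abs_D_powr s f) * Lp_norm q g"
proof -
  note [measurable] = schwartz_measurable[OF f] schwartz_measurable[OF g]
  have [measurable]: "abs_D_powr s f \<in> borel_measurable borel"
    unfolding abs_D_powr_def fourier_multiplier_def by measurable
  have C: "0 < m * modulus_const s" using mass modulus_const_pos[OF s] by simp
  consider "Lp_norm p (abs_D_powr s f) = 0 \<or> Lp_norm q g = 0"
    | "Lp_norm p (abs_D_powr s f) \<noteq> 0" "Lp_norm q g \<noteq> 0"
      "Lp_norm p (abs_D_powr s f) = \<infinity> \<or> Lp_norm q g = \<infinity>"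
    | a b where "Lp_norm p (abs_D_powr s f) = ennreal a" "0 \<le> a" "Lp_norm q g = ennreal b" "0 \<le> b"
    by (metis ennreal_cases infinity_ennreal_def)
  then show ?thesis
  proof cases
    case 1
    text \<open>The other factor may be \<open>\<infinity>\<close>, where \<open>0 * \<infinity> = 0\<close>, so the left-hand side has to vanish.\<close>
    have "Lp_norm r (\<lambda>x::'a. 0) \<le> ennreal 0"
      using pqr(3) by (intro Lp_norm_le) (auto simp: Lp_le_def)
    then show ?thesis
      using commutator_avg_eq_0[OF f g s pqr(1,2) 1, of Q] by simp
  next
    case 2
    then have "ennreal (m * modulus_const s) * Lp_norm p (abs_D_powr s f) * Lp_norm q g = \<infinity>"
      using C by (auto simp: ennreal_mult_eq_top_iff)
    then show ?thesis by simp
  next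
    case 3
    \<comment> \<open>The increments \<open>1 / Suc n\<close> keep both bounds positive whatever a
      and b are; they disappear in the limit.\<close>
    have le: "Lp_norm r (commutator_avg Q f g)
        \<le> ennreal (m * (modulus_const s * (a + 1 / real (Suc n)) * (b + 1 / real (Suc n))))" for n
    proof (rule Lp_le_commutator_avg[OF Q mass f g s pqr])
      show "Lp_le lborel p (\<lambda>x. norm (abs_D_powr s f x)) (a + 1 / real (Suc n))"
        by (rule Lp_le_bound_mono[OF Lp_norm_Lp_le[OF _ pqr(1) 3(1,2)]]) (use 3 in auto)
      show "Lp_le lborel q (\<lambda>x. norm (g x)) (b + 1 / real (Suc n))"
        by (rule Lp_le_bound_mono[OF Lp_norm_Lp_le[OF _ pqr(2) 3(3,4)]]) (use 3 in auto)
    qed (use 3 in \<open>auto intro: add_nonneg_pos\<close>)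
    have z: "(\<lambda>n. 1 / real (Suc n)) \<longlonglongrightarrow> 0"
      using LIMSEQ_inverse_real_of_nat by (simp add: inverse_eq_divide)
    have "(\<lambda>n. ennreal (m * (modulus_const s * (a + 1 / real (Suc n)) * (b + 1 / real (Suc n)))))
        \<longlonglongrightarrow> ennreal (m * (modulus_const s * (a + 0) * (b + 0)))"
      by (intro tendsto_ennrealI tendsto_intros z)
    then have "Lp_norm r (commutator_avg Q f g) \<le> ennreal (m * (modulus_const s * (a + 0) * (b + 0)))"
      by (rule LIMSEQ_le_const) (use le in blast)
    also have "\<dots> = ennreal (m * modulus_const s) * Lp_norm p (abs_D_powr s f) * Lp_norm q g"
      using 3 C by (simp add: ennreal_mult[symmetric] mult_ac)
    finally show ?thesis .
  qed
qed

theorem theorem1p1: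
  fixes P :: "real ^ 'n \<Rightarrow> complex"
    and \<epsilon> s :: real
    and p q r :: ennreal
  assumes "\<epsilon> > 0" and "0 < s" and "s < 1"
    and "integrable lebesgue P"
    and "\<exists>A>0. \<forall>j::nat. j \<ge> 1 \<longrightarrow>
           (LINT x:{x. 2 ^ (j - 1) \<le> norm x \<and> norm x \<le> 2 ^ j}|lebesgue. norm (P x))
             \<le> A * 2 powr (- (real j * (\<epsilon> + s)))"
    and "\<exists>A>0. (LINT x:{x. norm x \<le> 1}|lebesgue. norm (P x)) \<le> A"
    and "1 \<le> p" and "1 \<le> q" and "1 \<le> r"
    and "1 / p + 1 / q = 1 / r"
  shows "\<exists>C::real>0. \<forall>k::int. \<forall>f\<in>schwartz. \<forall>g\<in>schwartz.
           Lp_norm r (\<lambda>x. LINT y|lebesgue. dyadic_dilation k P y * (f x - f (x - y)) * g (x - y))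
             \<le> ennreal (C * 2 powr (- (real_of_int k * s)))
                 * Lp_norm p (abs_D_powr s f) * Lp_norm q g"
proof -
  note s = assms(2,3)
  have P: "P \<in> borel_measurable lebesgue" using assms(4) by (rule borel_measurable_integrable)
  let ?I = "\<integral>\<^sup>+ y. ennreal (norm (P y) * norm y powr s) \<partial>lebesgue"
  have "?I < \<infinity>"
    using assms(5) nn_integral_dyadic_weight_finite[OF assms(4,2,1)] by blast
  \<comment> \<open>Adding 1 to the integral keeps M positive even when P vanishes almost
    everywhere.\<close>
  then obtain M where M: "0 < M" "?I \<le> ennreal M"
    by (intro that[of "enn2real ?I + 1"]) (auto simp: add_nonneg_pos ennreal_plus)
  let ?C = "M * modulus_const s"
  show ?thesis
  proof (intro exI[of _ ?C] conjI allI ballI)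
    show "0 < ?C" using M modulus_const_pos[OF s] by simp
    fix k :: int and f g :: "real ^ 'n \<Rightarrow> complex"
    assume fg: "f \<in> schwartz" "g \<in> schwartz"
    let ?m = "2 powr (- (real_of_int k * s)) * M"
    have "(\<integral>\<^sup>+ y. ennreal (norm (dyadic_dilation k P y) * norm y powr s) \<partial>lebesgue) \<le> ennreal ?m"
      unfolding nn_integral_dyadic_dilation[OF P] using M by (simp add: ennreal_mult mult_left_mono)
    then have "Lp_norm r (commutator_avg (dyadic_dilation k P) f g)
        \<le> ennreal (?m * modulus_const s) * Lp_norm p (abs_D_powr s f) * Lp_norm q g"
      using M by (intro Lp_norm_commutator_avg dyadic_dilation_measurable P fg s assms) auto
    then show "Lp_norm r (\<lambda>x. LINT y|lebesgue. dyadic_dilation k P y * (f x - f (x - y)) * g (x - y))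
             \<le> ennreal (?C * 2 powr (- (real_of_int k * s))) * Lp_norm p (abs_D_powr s f) * Lp_norm q g"
      by (simp add: commutator_avg_def[abs_def] mult_ac)
  qed
qed

end
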